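(* Let $\{\mu^\theta:\theta\ge0\}$ be an infinitely divisible (convolution) semigroup of probability distributions on the nonnegative integers $\mathbb{N}_0=\{0,1,2,\dots\}$ with $\mu^\theta(\{1\})>0$ for $\theta>0$. Fix $\theta>0$ and $0<\rho<1$ and let $\{X_t\}_{t\in\mathbb{Z}}$ be the thinning process determined by $\{\mu^\theta\}$, $\theta$ and $\rho$ (defined in the context), which has, for each $t\in\mathbb{Z}$, the representation $$X_{t-1}=\xi_t+\eta_t,\qquad X_t=\xi_t+\zeta_t$$ with independent $\xi_t\sim\mu^{\rho\theta}$, $\eta_t\sim\mu^{(1-\rho)\theta}$, $\zeta_t\sim\mu^{(1-\rho)\theta}$. Then $X_t$ is Markov, stationary, time-reversible, and nonnegative integer valued, but it does not have infinitely divisible marginal distributions of all orders unless $\{\mu^\theta\}$ is the Poisson family.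
   Context: Convolution semigroup: $\mu^{\theta_1}*\mu^{\theta_2}=\mu^{\theta_1+\theta_2}$ for all $\theta_1,\theta_2\ge0$ and $\mu^0=\delta_0$. "$\{\mu^\theta\}$ is the Poisson family" means that for some constant $c>0$, $\mu^\theta$ is the Poisson distribution with mean $c\theta$ for every $\theta\ge 0$. Thinning process. For $\theta>0$ and $0<\rho<1$, the thinning distribution $\mu^\theta_\rho(dy\mid x)$ is the conditional distribution of $Y$ given $Y+Z=x$, where $Y\sim\mu^{\rho\theta}$ and $Z\sim\mu^{(1-\rho)\theta}$ are independent. The thinning process is the process $\{X_t\}_{t\in\mathbb{Z}}$ constructed, beginning at any $t_0\in\mathbb{Z}$, by: $X_{t_0}\sim\mu^\theta$; for $t\ne t_0$, moving successively away from $t_0$, set $X_t:=\xi_t+\zeta_t$, where, conditionally on the variables already constructed, $\xi_t\sim\mu^\theta_\rho(\cdot\mid x)$ with $x=X_{t-1}$ if $t>t_0$ and $x=X_{t+1}$ if $t<t_0$, and $\zeta_t\sim\mu^{(1-\rho)\theta}$ is independent of $\xi_t$ and of the variables already constructed; the steps forward from $t_0$ and those backward from $t_0$ are conditionally independent given $X_{t_0}$. (The law does not depend on $t_0$.) Its one-step transition probabilities are $$\mathsf{P}[X_{t+1}=y\mid X_t=x]=\frac{\sum_z\mu^{\rho\theta}(\{z\})\,\mu^{(1-\rho)\theta}(\{x-z\})\,\mu^{(1-\rho)\theta}(\{y-z\})}{\mu^\theta(\{x\})}.$$ The representation $X_{t-1}=\xi_t+\eta_t$, $X_t=\xi_t+\zeta_t$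 in the claim is a statement about the joint law of $(X_{t-1},X_t)$ for each single $t$. For a finite set $T\subset\mathbb{Z}$ let $\mu_T$ be the joint distribution of $X_T=(X_t)_{t\in T}$. The process is stationary if $\mu_T=\mu_{s+T}$ for all finite $T\subset\mathbb{Z}$ and $s\in\mathbb{Z}$; time-reversible if it is stationary and also $\mu_T=\mu_{-T}$ for all finite $T$, where $-T=\{-t:t\in T\}$ (coordinates matched by $t\leftrightarrow-t$); Markov if for every $t\in\mathbb{Z}$, every finite $T\subset\{s\in\mathbb{Z}:s\ge t\}$ and every Borel $B\subset\mathbb{R}^{|T|}$, $\mathsf{P}[X_T\in B\mid\mathcal{F}_t]=\mathsf{P}[X_T\in B\mid X_t]$, where $\mathcal{F}_t=\sigma\{X_s:s\le t\}$. It has infinitely divisible marginal distributions of all orders if for every finite $T\subset\mathbb{Z}$ there is a finite measure $\nu_T$ on $\mathbb{Z}^{|T|}$ with $\int e^{i\omega'x}\mu_T(dx)=\exp\{\int_{\mathbb{Z}^{|T|}}(e^{i\omega'u}-1)\,\nu_T(du)\}$ for all $\omega\in\mathbb{R}^{|T|}$ (equivalently, for each $n\ge1$, $\mu_T$ is the $n$-fold convolution of some probability distribution on $\mathbb{N}_0^{|T|}$). *)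

theory Defs
  imports "HOL-Probability.Probability"
begin

section \<open>Convolution semigroups on the nonnegative integers\<close>

text \<open>Only the values of \<open>\<mu>\<close> at nonnegative parameters are constrained.\<close>

definition conv_semigroup :: "(real \<Rightarrow> nat pmf) \<Rightarrow> bool" where
  "conv_semigroup \<mu> \<longleftrightarrow>
     \<mu> 0 = return_pmf 0 \<and>
     (\<forall>\<theta>\<^sub>1\<ge>0. \<forall>\<theta>\<^sub>2\<ge>0.
        map_pmf (\<lambda>(x, y). x + y) (pair_pmf (\<mu> \<theta>\<^sub>1) (\<mu> \<theta>\<^sub>2)) = \<mu> (\<theta>\<^sub>1 + \<theta>\<^sub>2))"

text \<open>
  The library's \<open>poisson_pmf r\<close> is specified only for \<open>r > 0\<close>; the Poisson distribution
  with mean zero is the point mass at zero.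
\<close>

definition poisson_family :: "(real \<Rightarrow> nat pmf) \<Rightarrow> bool" where
  "poisson_family \<mu> \<longleftrightarrow>
     (\<exists>c>0. \<mu> 0 = return_pmf 0 \<and> (\<forall>\<theta>>0. \<mu> \<theta> = poisson_pmf (c * \<theta>)))"

text \<open>
  The law of \<open>Y\<close> given \<open>Y + Z = x\<close>.  The function \<open>cond_pmf\<close> is specified only if the
  conditioning event has positive probability.  This holds for every \<open>x\<close> if \<open>\<mu>\<close> is a
  convolution semigroup charging \<open>1\<close> at all positive parameters, since then every
  \<open>\<mu> \<theta>\<close> with \<open>\<theta> > 0\<close> has full support.
\<close>

definition thinning_pmf :: "(real \<Rightarrow> nat pmf) \<Rightarrow> real \<Rightarrow> real \<Rightarrow> nat \<Rightarrow> nat pmf" where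
  "thinning_pmf \<mu> \<theta> \<rho> x =
     map_pmf fst (cond_pmf (pair_pmf (\<mu> (\<rho> * \<theta>)) (\<mu> ((1 - \<rho>) * \<theta>))) {(y, z). y + z = x})"


section \<open>Generated sigma-algebras and conditional probabilities\<close>

text \<open>The sigma-algebra generated by a set \<open>F\<close> of random variables with values in \<open>S\<close>.\<close>

definition gen_sigma :: "'a measure \<Rightarrow> 'b measure \<Rightarrow> ('a \<Rightarrow> 'b) set \<Rightarrow> 'a measure" where
  "gen_sigma M S F = sigma (space M) {f -` B \<inter> space M | f B. f \<in> F \<and> B \<in> sets S}"

definition cond_pr :: "'a measure \<Rightarrow> 'a measure \<Rightarrow> 'a set \<Rightarrow> 'a \<Rightarrow> real" where
  "cond_pr M F A = real_cond_exp M F (indicator A)"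

abbreviation nat_sigma :: "'a measure \<Rightarrow> ('a \<Rightarrow> nat) set \<Rightarrow> 'a measure" where
  "nat_sigma M F \<equiv> gen_sigma M (count_space UNIV) F"


section \<open>The thinning process constructed from time \<open>t\<^sub>0\<close>\<close>

text \<open>
  The values of \<open>\<xi>\<close> and \<open>\<zeta>\<close> at \<open>t\<^sub>0\<close> play no role.  The variables already constructed
  before a forward (backward) step are taken to be those between \<open>t\<^sub>0\<close> and the current
  time; the relation between the two directions is given by \<open>forward_backward\<close>.
\<close>

locale thinning_process = prob_space M for M :: "'a measure" +
  fixes \<mu> :: "real \<Rightarrow> nat pmf" and \<theta> \<rho> :: real and t\<^sub>0 :: int
    and X \<xi> \<zeta> :: "int \<Rightarrow> 'a \<Rightarrow> nat"
  assumes X_measurable: "\<And>t. X t \<in> measurable M (count_space UNIV)"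
    and \<xi>_measurable: "\<And>t. \<xi> t \<in> measurable M (count_space UNIV)"
    and \<zeta>_measurable: "\<And>t. \<zeta> t \<in> measurable M (count_space UNIV)"
    and X_start: "distr M (count_space UNIV) (X t\<^sub>0) = measure_pmf (\<mu> \<theta>)"
    and X_step: "\<And>t \<omega>. t \<noteq> t\<^sub>0 \<Longrightarrow> \<omega> \<in> space M \<Longrightarrow> X t \<omega> = \<xi> t \<omega> + \<zeta> t \<omega>"
    and \<zeta>_distr:
      "\<And>t. t \<noteq> t\<^sub>0 \<Longrightarrow> distr M (count_space UNIV) (\<zeta> t) = measure_pmf (\<mu> ((1 - \<rho>) * \<theta>))"
    and \<xi>_forward:
      "\<And>t y. t\<^sub>0 < t \<Longrightarrow>
         AE \<omega> in M.
           cond_pr M (nat_sigma M (X ` {t\<^sub>0..<t} \<union> \<xi> ` {t\<^sub>0<..<t} \<union> \<zeta> ` {t\<^sub>0<..<t}))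
             {\<omega> \<in> space M. \<xi> t \<omega> = y} \<omega>
           = pmf (thinning_pmf \<mu> \<theta> \<rho> (X (t - 1) \<omega>)) y"
    and \<zeta>_forward:
      "\<And>t. t\<^sub>0 < t \<Longrightarrow>
         indep_set (sets (nat_sigma M {\<zeta> t}))
           (sets (nat_sigma M (X ` {t\<^sub>0..<t} \<union> \<xi> ` {t\<^sub>0<..t} \<union> \<zeta> ` {t\<^sub>0<..<t})))"
    and \<xi>_backward:
      "\<And>t y. t < t\<^sub>0 \<Longrightarrow>
         AE \<omega> in M.
           cond_pr M (nat_sigma M (X ` {t<..t\<^sub>0} \<union> \<xi> ` {t<..<t\<^sub>0} \<union> \<zeta> ` {t<..<t\<^sub>0}))
             {\<omega> \<in> space M. \<xi> t \<omega> = y} \<omega>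
           = pmf (thinning_pmf \<mu> \<theta> \<rho> (X (t + 1) \<omega>)) y"
    and \<zeta>_backward:
      "\<And>t. t < t\<^sub>0 \<Longrightarrow>
         indep_set (sets (nat_sigma M {\<zeta> t}))
           (sets (nat_sigma M (X ` {t<..t\<^sub>0} \<union> \<xi> ` {t..<t\<^sub>0} \<union> \<zeta> ` {t<..<t\<^sub>0})))"
    and forward_backward:
      "\<And>A B. A \<in> sets (nat_sigma M (X ` {t\<^sub>0<..} \<union> \<xi> ` {t\<^sub>0<..} \<union> \<zeta> ` {t\<^sub>0<..})) \<Longrightarrow>
         B \<in> sets (nat_sigma M (X ` {..<t\<^sub>0} \<union> \<xi> ` {..<t\<^sub>0} \<union> \<zeta> ` {..<t\<^sub>0})) \<Longrightarrow>
         AE \<omega> in M.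
           cond_pr M (nat_sigma M {X t\<^sub>0}) (A \<inter> B) \<omega>
           = cond_pr M (nat_sigma M {X t\<^sub>0}) A \<omega> * cond_pr M (nat_sigma M {X t\<^sub>0}) B \<omega>"


section \<open>Properties of real-valued processes indexed by the integers\<close>

text \<open>The joint law of \<open>(X (\<phi> t))\<close> for \<open>t \<in> T\<close>, on coordinates indexed by \<open>T\<close>.\<close>

definition joint_law ::
  "'a measure \<Rightarrow> (int \<Rightarrow> 'a \<Rightarrow> real) \<Rightarrow> int set \<Rightarrow> (int \<Rightarrow> int) \<Rightarrow> (int \<Rightarrow> real) measure" where
  "joint_law M X T \<phi> = distr M (\<Pi>\<^sub>M t\<in>T. borel) (\<lambda>\<omega>. \<lambda>t\<in>T. X (\<phi> t) \<omega>)"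

definition stationary :: "'a measure \<Rightarrow> (int \<Rightarrow> 'a \<Rightarrow> real) \<Rightarrow> bool" where
  "stationary M X \<longleftrightarrow>
     (\<forall>T s. finite T \<longrightarrow> joint_law M X T (\<lambda>t. t) = joint_law M X T (\<lambda>t. s + t))"

definition time_reversible :: "'a measure \<Rightarrow> (int \<Rightarrow> 'a \<Rightarrow> real) \<Rightarrow> bool" where
  "time_reversible M X \<longleftrightarrow>
     stationary M X \<and>
     (\<forall>T. finite T \<longrightarrow> joint_law M X T (\<lambda>t. t) = joint_law M X T (\<lambda>t. - t))"

definition markov :: "'a measure \<Rightarrow> (int \<Rightarrow> 'a \<Rightarrow> real) \<Rightarrow> bool" where
  "markov M X \<longleftrightarrow>
     (\<forall>t. \<forall>T\<subseteq>{t..}. finite T \<longrightarrow>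
       (\<forall>B\<in>sets (\<Pi>\<^sub>M s\<in>T. borel).
         AE \<omega> in M.
           cond_pr M (gen_sigma M borel (X ` {..t})) {\<omega> \<in> space M. (\<lambda>s\<in>T. X s \<omega>) \<in> B} \<omega>
           = cond_pr M (gen_sigma M borel {X t}) {\<omega> \<in> space M. (\<lambda>s\<in>T. X s \<omega>) \<in> B} \<omega>))"

definition id_marginals_all_orders :: "'a measure \<Rightarrow> (int \<Rightarrow> 'a \<Rightarrow> real) \<Rightarrow> bool" where
  "id_marginals_all_orders M X \<longleftrightarrow>
     (\<forall>T. finite T \<longrightarrow>
       (\<exists>\<nu> :: (int \<Rightarrow> int) measure.
          sets \<nu> = sets (\<Pi>\<^sub>M t\<in>T. count_space UNIV) \<and> finite_measure \<nu> \<and>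
          (\<forall>w :: int \<Rightarrow> real.
             (CLINT x | joint_law M X T (\<lambda>t. t). iexp (\<Sum>t\<in>T. w t * x t))
             = exp (CLINT u | \<nu>. (iexp (\<Sum>t\<in>T. w t * of_int (u t)) - 1)))))"

end

theory Submission
  imports Defs
begin

text \<open>
  The one-step kernel \<open>K x y = J x y / p x\<close>, with \<open>p = \<mu> \<theta>\<close> and \<open>J\<close> the symmetric law of
  \<open>(x + y, x + z)\<close>, satisfies detailed balance.  Hence the probability of a path on an
  interval of times does not depend on \<open>t\<^sub>0\<close>, nor on the position or the direction of the
  interval, and it factorizes at every time.

  If three consecutive variables had an infinitely divisible law, that law would be compound
  Poisson.  Let \<open>F a c\<close> be the generating function in \<open>t\<close> of the probabilities of
  \<open>(a, j, c)\<close>.  Then the coefficients of \<open>F 0 0 * F 1 1 - F 1 0 * F 0 1\<close> divided by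
  \<open>(F 0 0)\<^sup>2\<close> are the masses that the jump measure gives to \<open>(1, j, 1)\<close>, so they are
  nonnegative.  If \<open>\<mu>\<close> agrees with a Poisson family below order \<open>k \<ge> 2\<close>, this bounds
  \<open>\<mu> \<theta> k\<close> by its Poisson value.  The excess over the Poisson value is additive in the
  parameter and nonnegative, so it vanishes for all parameters.
\<close>


section \<open>Convolution semigroups of full support\<close>

text \<open>Two times can never reveal a failure: \<open>(X (t - 1), X t)\<close> is a linear image
  of independent infinitely divisible variables, hence infinitely divisible for every semigroup.
  With three times, the division by \<open>p b\<close> in the joint law breaks this structure. The
  determinant of the \<open>F a c\<close> is not ad hoc. Divided by \<open>(F 0 0)\<^sup>2\<close>
  it is the mixed second derivative, at zero, of the logarithm of the joint generating function in
  the two outer variables. For a compound Poisson law this logarithm is, up to a constant, the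
  generating function of the jump measure, so the derivative picks out the jumps with both outer
  coordinates equal to 1. The jump measure in the definition lives on integer triples, while the
  process has values in the naturals; its support must be located before generating functions make
  sense.\<close>

lemma pmf_convolution:
  fixes p q :: "nat pmf"
  shows "pmf (map_pmf (\<lambda>(x, y). x + y) (pair_pmf p q)) n = (\<Sum>i\<le>n. pmf p i * pmf q (n - i))"
proof -
  have "(\<lambda>(x, y). x + y) -` {n} = (\<lambda>i. (i, n - i)) ` {..n}"
    by (auto simp: image_iff)
  moreover have "inj_on (\<lambda>i. (i, n - i)) {..n}"
    by (auto simp: inj_on_def)
  ultimately show ?thesis
    by (simp add: pmf_map measure_measure_pmf_finite sum.reindex pmf_pair)
qed

lemma pmf_nat_sums:
  fixes p :: "nat pmf"
  shows "pmf p sums 1"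
proof -
  have "(\<lambda>i. measure p {i}) sums measure p (\<Union>i. {i})"
    by (rule measure_pmf.finite_measure_UNION) (auto simp: disjoint_family_on_def)
  then show ?thesis
    by (simp add: measure_pmf_single)
qed

section \<open>Pairs with a common summand\<close>

definition overlap_pmf :: "nat pmf \<Rightarrow> nat pmf \<Rightarrow> (nat \<times> nat) pmf" where
  "overlap_pmf q r = map_pmf (\<lambda>(x, y, z). (x + y, x + z)) (pair_pmf q (pair_pmf r r))"

lemma pmf_overlap:
  "pmf (overlap_pmf q r) (x, y) = (\<Sum>z\<le>min x y. pmf q z * pmf r (x - z) * pmf r (y - z))"
proof -
  have "(\<lambda>(x, y, z). (x + y, x + z)) -` {(x, y)} = (\<lambda>z. (z, x - z, y - z)) ` {..min x y}"
    by (auto simp: image_iff)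
  moreover have "inj_on (\<lambda>z. (z, x - z, y - z)) {..min x y}"
    by (auto simp: inj_on_def)
  ultimately show ?thesis
    by (simp add: overlap_pmf_def pmf_map measure_measure_pmf_finite sum.reindex pmf_pair mult.assoc)
qed

lemma pmf_overlap_commute: "pmf (overlap_pmf q r) (x, y) = pmf (overlap_pmf q r) (y, x)"
  by (simp add: pmf_overlap min.commute mult_ac)

lemma map_fst_overlap: "map_pmf fst (overlap_pmf q r) = map_pmf (\<lambda>(x, y). x + y) (pair_pmf q r)"
proof -
  have "map_pmf fst (overlap_pmf q r) =
      map_pmf (\<lambda>(x, y). x + y) (map_pmf (\<lambda>(x, y). (x, fst y)) (pair_pmf q (pair_pmf r r)))"
    by (simp add: overlap_pmf_def pmf.map_comp o_def case_prod_beta)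
  also have "map_pmf (\<lambda>(x, y). (x, fst y)) (pair_pmf q (pair_pmf r r)) = pair_pmf q r"
    using map_pair[of "\<lambda>x. x" fst q "pair_pmf r r"] by (simp add: map_fst_pair_pmf pmf.map_ident)
  finally show ?thesis .
qed

lemma overlap_sums: "(\<lambda>y. pmf (overlap_pmf q r) (x, y)) sums
    pmf (map_pmf (\<lambda>(x, y). x + y) (pair_pmf q r)) x"
proof -
  have "(\<lambda>y. measure (overlap_pmf q r) {(x, y)}) sums measure (overlap_pmf q r) (\<Union>y::nat. {(x, y)})"
    by (rule measure_pmf.finite_measure_UNION) (auto simp: disjoint_family_on_def)
  moreover have "(\<Union>y::nat. {(x, y)}) = fst -` {x}" by auto
  ultimately show ?thesis
    by (simp only: measure_pmf_single pmf_map flip: map_fst_overlap)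
qed

locale charging_semigroup =
  fixes \<mu> :: "real \<Rightarrow> nat pmf"
  assumes semigroup: "conv_semigroup \<mu>"
    and charges_one: "0 < s \<Longrightarrow> 0 < pmf (\<mu> s) 1"
begin

lemma convolution: "0 \<le> s \<Longrightarrow> 0 \<le> u \<Longrightarrow> map_pmf (\<lambda>(x, y). x + y) (pair_pmf (\<mu> s) (\<mu> u)) = \<mu> (s + u)"
  using semigroup by (auto simp: conv_semigroup_def)

lemma convolution_split:
  assumes "0 \<le> \<theta>" "0 \<le> \<rho>" "\<rho> \<le> 1"
  shows "map_pmf (\<lambda>(x, y). x + y) (pair_pmf (\<mu> (\<rho> * \<theta>)) (\<mu> ((1 - \<rho>) * \<theta>))) = \<mu> \<theta>"
  using convolution[of "\<rho> * \<theta>" "(1 - \<rho>) * \<theta>"] assms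
  by (simp only: mult_nonneg_nonneg diff_ge_0_iff_ge flip: distrib_right) simp

lemma pmf_add: "0 \<le> s \<Longrightarrow> 0 \<le> u \<Longrightarrow> pmf (\<mu> (s + u)) n = (\<Sum>i\<le>n. pmf (\<mu> s) i * pmf (\<mu> u) (n - i))"
  by (simp flip: convolution add: pmf_convolution)

text \<open>Halving the parameter suffices. Mass at 1 for \<open>s\<close> forces mass at 0 for
  \<open>s/2\<close>, hence mass at 0 for \<open>s\<close>; and one unit from one half together with
  \<open>n\<close> units from the other reach \<open>Suc n\<close>.\<close>

lemma full_support: "0 < s \<Longrightarrow> 0 < pmf (\<mu> s) n"
proof (induction n arbitrary: s)
  case 0
  have "pmf (\<mu> s) 1 = pmf (\<mu> (s/2)) 0 * pmf (\<mu> (s/2)) 1 + pmf (\<mu> (s/2)) 1 * pmf (\<mu> (s/2)) 0"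
    using pmf_add[of "s/2" "s/2" 1] 0 by simp
  then have "pmf (\<mu> (s/2)) 0 \<noteq> 0"
    using charges_one[OF 0] by auto
  moreover have "pmf (\<mu> s) 0 = pmf (\<mu> (s/2)) 0 * pmf (\<mu> (s/2)) 0"
    using pmf_add[of "s/2" "s/2" 0] 0 by simp
  ultimately show ?case
    using pmf_nonneg[of "\<mu> (s/2)" 0] by (simp add: less_le)
next
  case (Suc n)
  have "0 < pmf (\<mu> (s/2)) 1 * pmf (\<mu> (s/2)) (Suc n - 1)"
    using Suc charges_one by simp
  also have "\<dots> \<le> (\<Sum>i\<le>Suc n. pmf (\<mu> (s/2)) i * pmf (\<mu> (s/2)) (Suc n - i))"
    by (rule member_le_sum) auto
  also have "\<dots> = pmf (\<mu> s) (Suc n)"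
    using pmf_add[of "s/2" "s/2" "Suc n"] Suc.prems by simp
  finally show ?case .
qed

lemma pmf_thinning:
  assumes "0 < \<theta>" "0 < \<rho>" "\<rho> < 1"
  shows "pmf (thinning_pmf \<mu> \<theta> \<rho> x) z =
    (if z \<le> x then pmf (\<mu> (\<rho> * \<theta>)) z * pmf (\<mu> ((1 - \<rho>) * \<theta>)) (x - z) / pmf (\<mu> \<theta>) x else 0)"
proof -
  let ?P = "pair_pmf (\<mu> (\<rho> * \<theta>)) (\<mu> ((1 - \<rho>) * \<theta>))" and ?S = "{(y, z). y + z = x} :: (nat \<times> nat) set"
  have pos: "0 < \<rho> * \<theta>" "0 < (1 - \<rho>) * \<theta>" using assms by auto
  have "map_pmf (\<lambda>(x, y). x + y) ?P = \<mu> \<theta>"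
    using assms by (intro convolution_split) auto
  then have "pmf (\<mu> \<theta>) x = pmf (map_pmf (\<lambda>(x, y). x + y) ?P) x"
    by (rule arg_cong[OF sym])
  also have "\<dots> = measure ?P ?S"
    unfolding pmf_map by (rule arg_cong[where f = "measure _"]) auto
  finally have S: "measure ?P ?S = pmf (\<mu> \<theta>) x" ..
  \<comment> \<open>\<open>cond_pmf\<close> is specified only for events that meet the support;
    \<open>(0, x)\<close> is a supported point with sum \<open>x\<close>.\<close>
  have "(0, x) \<in> set_pmf ?P"
    using full_support pos by (simp add: set_pmf_iff pmf_pair less_imp_neq[symmetric])
  then have ne: "set_pmf ?P \<inter> ?S \<noteq> {}"
    by (intro notI) (auto dest!: equalityD1)
  have "pmf (thinning_pmf \<mu> \<theta> \<rho> x) z = measure (cond_pmf ?P ?S) (fst -` {z})"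
    by (simp add: thinning_pmf_def pmf_map)
  also have "\<dots> = measure (cond_pmf ?P ?S) (if z \<le> x then {(z, x - z)} else {})"
    by (rule measure_pmf.finite_measure_eq_AE)
       (auto simp: AE_measure_pmf_iff set_cond_pmf[OF ne])
  also have "\<dots> = (if z \<le> x then pmf ?P (z, x - z) / measure ?P ?S else 0)"
    by (auto simp: measure_pmf_single pmf_cond[OF ne])
  finally show ?thesis
    by (simp add: S pmf_pair)
qed

end

section \<open>Conditional probabilities given a discrete variable\<close>

lemma space_gen_sigma [simp]: "space (gen_sigma M S F) = space M"
  by (auto simp: gen_sigma_def space_measure_of_conv)

lemma sets_gen_sigma:
  "sets (gen_sigma M S F) = sigma_sets (space M) {f -` B \<inter> space M | f B. f \<in> F \<and> B \<in> sets S}"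
  unfolding gen_sigma_def by (rule sets_measure_of) auto

lemma gen_sigma_mono: "F \<subseteq> F' \<Longrightarrow> sets (gen_sigma M S F) \<subseteq> sets (gen_sigma M S F')"
  unfolding sets_gen_sigma by (rule sigma_sets_mono') blast

lemma subalgebra_gen_sigma:
  assumes "F \<subseteq> measurable M S"
  shows "subalgebra M (gen_sigma M S F)"
  unfolding subalgebra_def
proof
  show "sets (gen_sigma M S F) \<subseteq> sets M"
    unfolding sets_gen_sigma using assms
    by (intro sets.sigma_sets_subset) (auto intro: measurable_sets)
qed simp

lemma measurable_gen_sigma:
  assumes "f \<in> F" "f \<in> space M \<rightarrow> space S"
  shows "f \<in> measurable (gen_sigma M S F) S"
  using assms by (intro measurableI) (auto simp: sets_gen_sigma intro!: sigma_sets.Basic)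

lemma measurable_nat_sigma: "f \<in> F \<Longrightarrow> f \<in> measurable (nat_sigma M F) (count_space UNIV)"
  by (rule measurable_gen_sigma) auto

lemma sets_Collect_map_eq:
  fixes f :: "'t \<Rightarrow> 'a \<Rightarrow> nat"
  assumes "\<And>t. t \<in> set ts \<Longrightarrow> f t \<in> measurable N (count_space UNIV)"
  shows "{\<omega> \<in> space N. map (\<lambda>t. f t \<omega>) ts = xs} \<in> sets N"
  using assms
proof (induction ts arbitrary: xs)
  case Nil
  then show ?case by (cases xs) auto
next
  case (Cons t ts)
  show ?case
  proof (cases xs)
    case (Cons x xs')
    have [measurable]: "f t \<in> measurable N (count_space UNIV)"
      using Cons.prems by simp
    have "{\<omega> \<in> space N. f t \<omega> = x} \<in> sets N" by measurable
    moreover have "{\<omega> \<in> space N. map (\<lambda>t. f t \<omega>) ts = xs'} \<in> sets N"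
      using Cons.prems Cons.IH by simp
    ultimately show ?thesis
      using sets.sets_Collect_conj by (simp add: Cons)
  qed simp
qed

lemma measurable_map_list:
  fixes f :: "'t \<Rightarrow> 'a \<Rightarrow> nat"
  assumes "\<And>t. t \<in> set ts \<Longrightarrow> f t \<in> measurable N (count_space UNIV)"
  shows "(\<lambda>\<omega>. map (\<lambda>t. f t \<omega>) ts) \<in> measurable N (count_space UNIV)"
  using sets_Collect_map_eq[OF assms]
  by (auto simp: measurable_count_space_eq2_countable vimage_def Int_def conj_commute)

text \<open>Countable additivity over the points of the value type, enumerated by
  \<open>to_nat\<close>. The factors \<open>c\<close> and \<open>c'\<close> let a cross-multiplied
  conditional independence pass from single values to arbitrary sets of values.\<close>

lemma (in finite_measure) measure_vimage_eq_from_points: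
  fixes f :: "'a \<Rightarrow> 'b::countable"
  assumes f [measurable]: "f \<in> measurable M (count_space UNIV)"
    and [measurable]: "A \<in> sets M" "A' \<in> sets M"
    and eq: "\<And>y. c * measure M {\<omega> \<in> A. f \<omega> = y} = c' * measure M {\<omega> \<in> A'. f \<omega> = y}"
  shows "c * measure M {\<omega> \<in> A. f \<omega> \<in> L} = c' * measure M {\<omega> \<in> A'. f \<omega> \<in> L}"
proof -
  have *: "(\<lambda>n. a * measure M {\<omega> \<in> S. f \<omega> \<in> L \<and> to_nat (f \<omega>) = n}) sums (a * measure M {\<omega> \<in> S. f \<omega> \<in> L})"
    if [measurable]: "S \<in> sets M" for S a
  proof (rule sums_mult)
    have "(\<lambda>n. measure M {\<omega> \<in> S. f \<omega> \<in> L \<and> to_nat (f \<omega>) = n}) sums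
        measure M (\<Union>n. {\<omega> \<in> S. f \<omega> \<in> L \<and> to_nat (f \<omega>) = n})"
      by (rule finite_measure_UNION) (auto simp: disjoint_family_on_def)
    also have "(\<Union>n. {\<omega> \<in> S. f \<omega> \<in> L \<and> to_nat (f \<omega>) = n}) = {\<omega> \<in> S. f \<omega> \<in> L}" by auto
    finally show "(\<lambda>n. measure M {\<omega> \<in> S. f \<omega> \<in> L \<and> to_nat (f \<omega>) = n}) sums measure M {\<omega> \<in> S. f \<omega> \<in> L}" .
  qed
  have "c * measure M {\<omega> \<in> A. f \<omega> \<in> L \<and> to_nat (f \<omega>) = n} =
      c' * measure M {\<omega> \<in> A'. f \<omega> \<in> L \<and> to_nat (f \<omega>) = n}" for n
  proof (cases "\<exists>y\<in>L. to_nat y = n")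
    case True
    then obtain y where y: "y \<in> L" "to_nat y = n" by blast
    then have "{\<omega> \<in> S. f \<omega> \<in> L \<and> to_nat (f \<omega>) = n} = {\<omega> \<in> S. f \<omega> = y}" for S
      by auto
    then show ?thesis using eq by simp
  next
    case False
    then have "{\<omega> \<in> S. f \<omega> \<in> L \<and> to_nat (f \<omega>) = n} = {}" for S
      by auto
    then show ?thesis by (simp only: measure_empty mult_zero_right)
  qed
  then show ?thesis
    using *[OF \<open>A \<in> sets M\<close>, of c] *[OF \<open>A' \<in> sets M\<close>, of c'] by (simp add: sums_iff)
qed

lemma (in prob_space) set_integral_cond_pr:
  assumes "subalgebra M F" "C \<in> events" "S \<in> sets F"
  shows "(LINT \<omega>:S|M. cond_pr M F C \<omega>) = prob (S \<inter> C)"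
proof -
  interpret finite_measure_subalgebra M F
    using assms(1) by unfold_locales
  have "S \<in> events" using assms by (auto simp: subalgebra_def)
  have "(LINT \<omega>:S|M. cond_pr M F C \<omega>) = (LINT \<omega>:S|M. indicator C \<omega>)"
    unfolding cond_pr_def using assms
    by (intro real_cond_exp_intA[symmetric] integrable_real_indicator) (auto simp: less_top[symmetric])
  also have "\<dots> = (LINT \<omega>|M. indicator (S \<inter> C) \<omega>)"
    by (simp add: set_lebesgue_integral_def indicator_inter_arith)
  finally show ?thesis
    using assms(2) \<open>S \<in> events\<close> by (simp add: Int_absorb2 sets.sets_into_space)
qed

text \<open>The candidate is the elementary conditional probability given \<open>Y\<close>. By the
  pi-lambda theorem its integrals need checking only on the generator \<open>G\<close>. There
  \<open>Y\<close> is constant, so the integral is a product, and \<open>factor\<close>, which is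
  conditional independence given \<open>Y\<close> without division, is exactly what is
  required.\<close>

lemma (in prob_space) cond_pr_eqI:
  fixes Y :: "'a \<Rightarrow> nat"
  assumes sub: "subalgebra M F" and C [measurable]: "C \<in> events"
    and YF: "Y \<in> measurable F (count_space UNIV)"
    and G: "Int_stable G" "G \<subseteq> events" "sets F \<subseteq> sigma_sets (space M) G"
    and factor: "\<And>S. S \<in> G \<Longrightarrow> S \<noteq> {} \<Longrightarrow> \<exists>x. (\<forall>\<omega>\<in>S. Y \<omega> = x) \<and>
      prob (S \<inter> C) * prob {\<omega> \<in> space M. Y \<omega> = x} = prob S * prob (C \<inter> {\<omega> \<in> space M. Y \<omega> = x})"
    and pos: "\<And>x. 0 < prob {\<omega> \<in> space M. Y \<omega> = x}"
  shows "AE \<omega> in M. cond_pr M F C \<omega> =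
    prob (C \<inter> {\<omega>' \<in> space M. Y \<omega>' = Y \<omega>}) / prob {\<omega>' \<in> space M. Y \<omega>' = Y \<omega>}"
proof -
  define h where "h x = prob (C \<inter> {\<omega>' \<in> space M. Y \<omega>' = x}) / prob {\<omega>' \<in> space M. Y \<omega>' = x}" for x
  interpret finite_measure_subalgebra M F
    using sub by unfold_locales
  have Y [measurable]: "Y \<in> measurable M (count_space UNIV)"
    using YF sub by (rule measurable_from_subalg[rotated])
  have "0 \<le> h x" "h x \<le> 1" for x
    using pos[of x] by (auto simp: h_def divide_le_eq intro!: finite_measure_mono)
  then have int: "integrable M (\<lambda>\<omega>. h (Y \<omega>))"
    by (intro integrable_const_bound[where B = 1]) auto
  then have sint: "set_integrable M S (\<lambda>\<omega>. h (Y \<omega>))" if "S \<in> events" for S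
    unfolding set_integrable_def using that by (rule integrable_mult_indicator[rotated])
  define good where "good S \<longleftrightarrow> (LINT \<omega>:S|M. h (Y \<omega>)) = prob (S \<inter> C)" for S
  have const: "(LINT \<omega>:S|M. h (Y \<omega>)) = prob S * h x" if "\<forall>\<omega>\<in>S. Y \<omega> = x" "S \<in> events" for S x
  proof -
    have "(LINT \<omega>:S|M. h (Y \<omega>)) = (LINT \<omega>:S|M. h x)"
      using that by (intro set_lebesgue_integral_cong) auto
    then show ?thesis
      using that by (simp add: set_lebesgue_integral_def Int_absorb2 sets.sets_into_space)
  qed
  have un: "good (\<Union>i::nat. S i)" if S: "\<And>i. good (S i)" "disjoint_family S" "range S \<subseteq> events" for S
  proof -
    have "(LINT \<omega>:(\<Union>i. S i)|M. h (Y \<omega>)) = (\<Sum>i. LINT \<omega>:S i|M. h (Y \<omega>))"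
      using S by (intro lebesgue_integral_countable_add sint) (auto simp: disjoint_family_on_def)
    also have "\<dots> = (\<Sum>i. prob (S i \<inter> C))"
      using S(1) by (simp add: good_def)
    also have "\<dots> = prob (\<Union>i. S i \<inter> C)"
      using S(2,3) by (intro sums_unique[symmetric] finite_measure_UNION) (auto simp: disjoint_family_on_def)
    also have "(\<Union>i. S i \<inter> C) = (\<Union>i. S i) \<inter> C" by auto
    finally show ?thesis by (simp add: good_def)
  qed
  \<comment> \<open>The whole space need not belong to \<open>G\<close>; its identity is assembled
    from the level sets of \<open>Y\<close>, and the complement step below subtracts from
    it.\<close>
  have "good {\<omega> \<in> space M. Y \<omega> = x}" for x
    using const[of "{\<omega> \<in> space M. Y \<omega> = x}" x] pos[of x]
    by (simp add: good_def h_def Int_commute)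
  then have "good (\<Union>x. {\<omega> \<in> space M. Y \<omega> = x})"
    by (intro un) (auto simp: disjoint_family_on_def)
  also have "(\<Union>x. {\<omega> \<in> space M. Y \<omega> = x}) = space M" by auto
  finally have top: "good (space M)" .
  have *: "good S" if "S \<in> sets F" for S
  proof -
    have Pow: "G \<subseteq> Pow (space M)" using G(2) sets.sets_into_space by blast
    have "S \<in> sigma_sets (space M) G" using that G(3) by blast
    then show ?thesis
    proof (induction rule: sigma_sets_induct_disjoint[OF G(1) Pow, consumes 1, case_names basic empty compl union])
      case (basic S)
      show ?case
      proof (cases "S = {}")
        case False
        then obtain x where x: "\<forall>\<omega>\<in>S. Y \<omega> = x"
          "prob (S \<inter> C) * prob {\<omega> \<in> space M. Y \<omega> = x} = prob S * prob (C \<inter> {\<omega> \<in> space M. Y \<omega> = x})"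
          using factor basic by blast
        moreover have "S \<in> events" using basic G(2) by blast
        ultimately show ?thesis
          using pos[of x] unfolding good_def const[OF x(1) \<open>S \<in> events\<close>] by (simp add: h_def field_simps)
      qed (simp add: good_def set_lebesgue_integral_def)
    next
      case empty
      then show ?case by (simp add: good_def set_lebesgue_integral_def)
    next
      case (compl S)
      have S [measurable]: "S \<in> events"
        using compl(1) G(2) by (metis sets.sigma_sets_subset subsetD)
      have "(LINT \<omega>:space M - S|M. h (Y \<omega>)) = (LINT \<omega>:space M|M. h (Y \<omega>)) - (LINT \<omega>:S|M. h (Y \<omega>))"
        using set_integral_Un[of S "space M - S" M "\<lambda>\<omega>. h (Y \<omega>)"] sint[OF S] sint[of "space M - S"] S
        by (simp add: Un_absorb1 sets.sets_into_space)
      also have "\<dots> = prob (space M \<inter> C) - prob (S \<inter> C)"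
        using top compl by (simp add: good_def)
      also have "\<dots> = prob (space M \<inter> C - S \<inter> C)"
        using S sets.sets_into_space[OF S] by (intro finite_measure_Diff[symmetric]) auto
      also have "space M \<inter> C - S \<inter> C = (space M - S) \<inter> C"
          using sets.sets_into_space[OF C] by auto
      finally show ?case by (simp add: good_def)
    next
      case (union S)
      have "range S \<subseteq> events"
        using union(2) G(2) by (metis sets.sigma_sets_subset subset_trans)
      then show ?case using union by (intro un) auto
    qed
  qed
  show ?thesis
    unfolding cond_pr_def h_def[symmetric]
  proof (rule real_cond_exp_charact)
    show "(LINT \<omega>:S|M. indicator C \<omega>) = (LINT \<omega>:S|M. h (Y \<omega>))" if "S \<in> sets F" for S
      using *[OF that] set_integral_cond_pr[OF sub C that] real_cond_exp_intA[of "indicator C" S] that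
      by (simp add: good_def cond_pr_def less_top[symmetric] integrable_real_indicator)
    show "(\<lambda>\<omega>. h (Y \<omega>)) \<in> borel_measurable F"
      using YF by measurable
  qed (auto simp: int less_top[symmetric] intro!: integrable_real_indicator)
qed

section \<open>Path probabilities\<close>

primrec path_weight :: "(nat \<Rightarrow> nat \<Rightarrow> real) \<Rightarrow> nat \<Rightarrow> nat list \<Rightarrow> real" where
  "path_weight K x [] = 1"
| "path_weight K x (y # ys) = K x y * path_weight K y ys"

lemma path_weight_append:
  "path_weight K x (ys @ zs) = path_weight K x ys * path_weight K (last (x # ys)) zs"
  by (induction ys arbitrary: x) auto

text \<open>Time is counted by steps away from the start, so that one statement serves both
  directions. \<open>F n\<close> is the history before step \<open>n\<close>, and \<open>K\<close>
  is the kernel "thin, then add an independent variable". The induction extends the list at its end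
  because the hypotheses condition on the past.\<close>

lemma (in prob_space) chain_law:
  fixes Y \<xi> \<zeta> :: "nat \<Rightarrow> 'a \<Rightarrow> nat"
  assumes [measurable]: "\<And>n. \<xi> n \<in> measurable M (count_space UNIV)"
      "\<And>n. \<zeta> n \<in> measurable M (count_space UNIV)"
    and start: "\<And>x. prob {\<omega> \<in> space M. Y 0 \<omega> = x} = pmf p x"
    and step: "\<And>n \<omega>. \<omega> \<in> space M \<Longrightarrow> Y (Suc n) \<omega> = \<xi> n \<omega> + \<zeta> n \<omega>"
    and sub: "\<And>n. subalgebra M (F n)"
    and YF: "\<And>n i. i \<le> n \<Longrightarrow> Y i \<in> measurable (F n) (count_space UNIV)"
    and \<xi>: "\<And>n z. AE \<omega> in M. cond_pr M (F n) {\<omega> \<in> space M. \<xi> n \<omega> = z} \<omega> = pmf (\<kappa> (Y n \<omega>)) z"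
    and \<zeta>: "\<And>n S z w. S \<in> sets (F n) \<Longrightarrow>
      prob (S \<inter> {\<omega> \<in> space M. \<xi> n \<omega> = z} \<inter> {\<omega> \<in> space M. \<zeta> n \<omega> = w}) =
      prob (S \<inter> {\<omega> \<in> space M. \<xi> n \<omega> = z}) * pmf r w"
    and K: "\<And>x y. K x y = (\<Sum>z\<le>y. pmf (\<kappa> x) z * pmf r (y - z))"
  shows "prob {\<omega> \<in> space M. map (\<lambda>i. Y i \<omega>) [0..<Suc (length ys)] = x # ys} = pmf p x * path_weight K x ys"
proof (induction ys rule: rev_induct)
  case Nil
  then show ?case using start by simp
next
  case (snoc y ys)
  let ?m = "length ys" and ?v = "last (x # ys)"
  define S where "S = {\<omega> \<in> space M. map (\<lambda>i. Y i \<omega>) [0..<Suc ?m] = x # ys}"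
  have space: "space (F ?m) = space M"
    using sub[of ?m] by (simp add: subalgebra_def)
  have SF: "S \<in> sets (F ?m)"
    unfolding S_def space[symmetric] by (rule sets_Collect_map_eq) (auto intro: YF)
  then have [measurable]: "S \<in> events"
    using sub[of ?m] by (auto simp: subalgebra_def)
  have last: "Y ?m \<omega> = ?v" if "\<omega> \<in> S" for \<omega>
  proof -
    have "last (map (\<lambda>i. Y i \<omega>) [0..<Suc ?m]) = ?v"
      using that unfolding S_def by (metis (mono_tags, lifting) mem_Collect_eq)
    then show ?thesis by simp
  qed
  \<comment> \<open>On \<open>S\<close> the current state is the constant \<open>?v\<close>, so
    integrating the conditional law of \<open>\<xi>\<close> over \<open>S\<close> gives a
    product.\<close>
  have xi: "prob (S \<inter> {\<omega> \<in> space M. \<xi> ?m \<omega> = z}) = prob S * pmf (\<kappa> ?v) z" for z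
  proof -
    have "prob (S \<inter> {\<omega> \<in> space M. \<xi> ?m \<omega> = z}) =
        (LINT \<omega>:S|M. cond_pr M (F ?m) {\<omega> \<in> space M. \<xi> ?m \<omega> = z} \<omega>)"
      by (rule set_integral_cond_pr[OF sub _ SF, symmetric]) measurable
    also have "\<dots> = (LINT \<omega>:S|M. pmf (\<kappa> ?v) z)"
    proof (rule set_lebesgue_integral_cong_AE)
      show "(\<lambda>\<omega>. cond_pr M (F ?m) {\<omega> \<in> space M. \<xi> ?m \<omega> = z} \<omega>) \<in> borel_measurable M"
        unfolding cond_pr_def by (rule measurable_from_subalg[OF sub borel_measurable_cond_exp])
      show "AE \<omega>\<in>S in M. cond_pr M (F ?m) {\<omega> \<in> space M. \<xi> ?m \<omega> = z} \<omega> = pmf (\<kappa> ?v) z"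
        using \<xi>[of ?m z] by eventually_elim (auto simp: last)
    qed auto
    finally show ?thesis
      by (simp add: set_lebesgue_integral_def Int_absorb2 sets.sets_into_space)
  qed
  have "{\<omega> \<in> space M. map (\<lambda>i. Y i \<omega>) [0..<Suc (length (ys @ [y]))] = x # ys @ [y]} =
      (\<Union>z\<in>{..y}. S \<inter> {\<omega> \<in> space M. \<xi> ?m \<omega> = z} \<inter> {\<omega> \<in> space M. \<zeta> ?m \<omega> = y - z})"
    using append_eq_append_conv[of "map (\<lambda>i. Y i _) [0..<Suc ?m]" "x # ys" "[Y (Suc ?m) _]" "[y]"]
    by (auto simp: S_def step)
  also have "prob \<dots> = (\<Sum>z\<le>y. prob (S \<inter> {\<omega> \<in> space M. \<xi> ?m \<omega> = z} \<inter> {\<omega> \<in> space M. \<zeta> ?m \<omega> = y - z}))"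
    by (rule finite_measure_finite_Union) (auto simp: disjoint_family_on_def)
  also have "\<dots> = prob S * K ?v y"
    by (simp add: \<zeta>[OF SF] xi K sum_distrib_left mult_ac)
  also have "\<dots> = pmf p x * path_weight K x (ys @ [y])"
    using snoc.IH by (simp add: S_def path_weight_append)
  finally show ?case .
qed

lemma upto_conv_map_upt: "[a..a + int n] = map (\<lambda>i. a + int i) [0..<Suc n]"
  by (rule nth_equalityI) (auto simp: nth_upto nth_append simp del: upt_Suc)

lemma rev_upto_conv_map_upt: "rev [a - int n..a] = map (\<lambda>i. a - int i) [0..<Suc n]"
  by (rule nth_equalityI) (auto simp: rev_nth nth_upto simp del: upt_Suc)

lemma upto_shift: "[s + a..s + b] = map (\<lambda>t. s + t) [a..b]"
  by (rule nth_equalityI) (auto simp: nth_upto)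

lemma upto_reflect: "rev [- b..- a] = map (\<lambda>t. - t) [a..b]"
  by (rule nth_equalityI) (auto simp: rev_nth nth_upto)

text \<open>The map \<open>real\<close> is injective and images of sets of naturals are countable,
  hence Borel: passing to real values neither adds nor loses events.\<close>

lemma gen_sigma_real: "gen_sigma M borel ((\<lambda>f \<omega>. real (f \<omega>)) ` F) = nat_sigma M F"
proof -
  have "{g -` B \<inter> space M | g B. g \<in> (\<lambda>f \<omega>. real (f \<omega>)) ` F \<and> B \<in> sets borel} =
      {f -` B \<inter> space M | f B. f \<in> F \<and> B \<in> sets (count_space UNIV)}" (is "?L = ?R")
  proof (intro equalityI subsetI)
    fix S assume "S \<in> ?L"
    then obtain f B where "f \<in> F" "S = (\<lambda>\<omega>. real (f \<omega>)) -` B \<inter> space M" by blast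
    then have "f \<in> F \<and> S = f -` (real -` B) \<inter> space M" by auto
    then show "S \<in> ?R" by auto
  next
    fix S assume "S \<in> ?R"
    then obtain f B where "f \<in> F" "S = f -` B \<inter> space M" by blast
    then have "S = (\<lambda>\<omega>. real (f \<omega>)) -` (real ` B) \<inter> space M" "(\<lambda>\<omega>. real (f \<omega>)) \<in> (\<lambda>f \<omega>. real (f \<omega>)) ` F"
      by auto
    moreover have "real ` B \<in> sets borel"
      by (rule sets.countable) auto
    ultimately show "S \<in> ?L" by blast
  qed
  then show ?thesis by (simp add: gen_sigma_def)
qed

lemma (in prob_space) cond_pr_discrete:
  fixes Y :: "'a \<Rightarrow> nat"
  assumes Y [measurable]: "Y \<in> measurable M (count_space UNIV)" and C: "C \<in> events"
    and pos: "\<And>x. 0 < prob {\<omega> \<in> space M. Y \<omega> = x}"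
  shows "AE \<omega> in M. cond_pr M (nat_sigma M {Y}) C \<omega> =
    prob (C \<inter> {\<omega>' \<in> space M. Y \<omega>' = Y \<omega>}) / prob {\<omega>' \<in> space M. Y \<omega>' = Y \<omega>}"
proof (rule cond_pr_eqI)
  \<comment> \<open>Distinct level sets are disjoint, so adding the empty set makes the family
    intersection stable.\<close>
  let ?G = "insert {} (range (\<lambda>x. {\<omega> \<in> space M. Y \<omega> = x}))"
  show "subalgebra M (nat_sigma M {Y})" by (rule subalgebra_gen_sigma) simp
  show "Y \<in> measurable (nat_sigma M {Y}) (count_space UNIV)" by (rule measurable_nat_sigma) simp
  show "Int_stable ?G" by (auto simp: Int_stable_def)
  show "?G \<subseteq> events" by auto
  show "sets (nat_sigma M {Y}) \<subseteq> sigma_sets (space M) ?G"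
    unfolding sets_gen_sigma
  proof (intro sigma_sets_mono subsetI)
    fix S assume "S \<in> {f -` B \<inter> space M | f B. f \<in> {Y} \<and> B \<in> sets (count_space UNIV)}"
    then obtain B where S: "S = (\<Union>x\<in>B. {\<omega> \<in> space M. Y \<omega> = x})" by auto
    show "S \<in> sigma_sets (space M) ?G"
      unfolding S by (intro sigma_sets_UNION) (auto intro!: sigma_sets.Basic)
  qed
  show "\<exists>x. (\<forall>\<omega>\<in>S. Y \<omega> = x) \<and>
      prob (S \<inter> C) * prob {\<omega> \<in> space M. Y \<omega> = x} = prob S * prob (C \<inter> {\<omega> \<in> space M. Y \<omega> = x})"
    if S: "S \<in> ?G" "S \<noteq> {}" for S
  proof -
    obtain x where "S = {\<omega> \<in> space M. Y \<omega> = x}" using S by auto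
    then show ?thesis by (intro exI[of _ x]) (simp add: Int_commute)
  qed
qed (use assms in auto)

section \<open>Laws of windows of the thinning process\<close>

locale charging_thinning = thinning_process M \<mu> \<theta> \<rho> t\<^sub>0 X \<xi> \<zeta> + charging_semigroup \<mu>
  for M :: "'a measure" and \<mu> \<theta> \<rho> t\<^sub>0 X \<xi> \<zeta> +
  assumes pos_\<theta>: "0 < \<theta>" and pos_\<rho>: "0 < \<rho>" and \<rho>_less: "\<rho> < 1"
begin

declare X_measurable [measurable] \<xi>_measurable [measurable] \<zeta>_measurable [measurable]

definition pair_law :: "(nat \<times> nat) pmf" where
  "pair_law = overlap_pmf (\<mu> (\<rho> * \<theta>)) (\<mu> ((1 - \<rho>) * \<theta>))"

definition kernel :: "nat \<Rightarrow> nat \<Rightarrow> real" where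
  "kernel x y = pmf pair_law (x, y) / pmf (\<mu> \<theta>) x"

text \<open>The candidate probability of a path. The value 1 at the empty list is the mass of the
  whole space, which remains when the only state of a one-point window is summed out.\<close>

definition weight :: "nat list \<Rightarrow> real" where
  "weight xs = (case xs of [] \<Rightarrow> 1 | x # ys \<Rightarrow> pmf (\<mu> \<theta>) x * path_weight kernel x ys)"

lemma start_pos: "0 < pmf (\<mu> \<theta>) x"
  using full_support pos_\<theta> by blast

lemma start_kernel: "pmf (\<mu> \<theta>) x * kernel x y = pmf pair_law (x, y)"
  using start_pos[of x] by (simp add: kernel_def)

lemma detailed_balance: "pmf (\<mu> \<theta>) x * kernel x y = pmf (\<mu> \<theta>) y * kernel y x"
  unfolding start_kernel by (simp add: pair_law_def pmf_overlap_commute[of _ _ x])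

lemma pair_law_sums: "(\<lambda>y. pmf pair_law (x, y)) sums pmf (\<mu> \<theta>) x"
  using overlap_sums[of "\<mu> (\<rho> * \<theta>)" "\<mu> ((1 - \<rho>) * \<theta>)" x] convolution_split[of \<theta> \<rho>] pos_\<theta> pos_\<rho> \<rho>_less
  by (simp add: pair_law_def)

lemma kernel_eq_thinning:
  "kernel x y = (\<Sum>z\<le>y. pmf (thinning_pmf \<mu> \<theta> \<rho> x) z * pmf (\<mu> ((1 - \<rho>) * \<theta>)) (y - z))"
proof -
  have "kernel x y = (\<Sum>z\<le>min x y. pmf (thinning_pmf \<mu> \<theta> \<rho> x) z * pmf (\<mu> ((1 - \<rho>) * \<theta>)) (y - z))"
    unfolding kernel_def pair_law_def pmf_overlap sum_divide_distrib
    using pos_\<theta> pos_\<rho> \<rho>_less by (intro sum.cong) (auto simp: pmf_thinning)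
  \<comment> \<open>The added terms have \<open>x < z\<close>, where the thinning law has mass
    zero.\<close>
  also have "\<dots> = (\<Sum>z\<le>y. pmf (thinning_pmf \<mu> \<theta> \<rho> x) z * pmf (\<mu> ((1 - \<rho>) * \<theta>)) (y - z))"
    using pos_\<theta> pos_\<rho> \<rho>_less by (intro sum.mono_neutral_left) (auto simp: pmf_thinning)
  finally show ?thesis .
qed

text \<open>A path can be rooted at any of its states: each use of detailed balance turns one step
  around and moves the stationary mass to the neighbouring state. Reversal invariance and
  factorization at a time both follow from this form.\<close>

lemma weight_rev_append:
  "weight (rev ys @ x # zs) = pmf (\<mu> \<theta>) x * path_weight kernel x ys * path_weight kernel x zs"
proof (induction ys arbitrary: x zs)
  case (Cons y ys)
  have "weight (rev (y # ys) @ x # zs) =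
      (pmf (\<mu> \<theta>) y * kernel y x) * path_weight kernel y ys * path_weight kernel x zs"
    using Cons[of y "x # zs"] by (simp add: mult_ac)
  then show ?case
    unfolding detailed_balance[of y x] by (simp add: mult_ac)
qed (simp add: weight_def)

lemma weight_rev: "weight (rev xs) = weight xs"
  using weight_rev_append[of _ _ "[]"] by (cases xs) (auto simp: weight_def)

lemma weight_append:
  "weight (us @ x # zs) = weight (us @ [x]) * path_weight kernel x zs"
  using weight_rev_append[of "rev us" x zs] weight_rev_append[of "rev us" x "[]"] by simp

text \<open>Detailed balance turns the first step around, after which the summed state is the target
  of a step and the row sum of \<open>pair_law\<close> applies.\<close>

lemma weight_Cons_sums: "(\<lambda>x. weight (x # xs)) sums weight xs"
proof (cases xs)
  case Nil
  then show ?thesis using pmf_nat_sums by (simp add: weight_def)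
next
  case (Cons y ys)
  have "(\<lambda>x. pmf pair_law (y, x) * path_weight kernel y ys) sums (pmf (\<mu> \<theta>) y * path_weight kernel y ys)"
    by (intro sums_mult2 pair_law_sums)
  then show ?thesis
    by (simp add: Cons weight_def detailed_balance[of _ y] flip: start_kernel mult.assoc)
qed

lemma weight_snoc_sums: "(\<lambda>x. weight (xs @ [x])) sums weight xs"
  using weight_Cons_sums[of "rev xs"] weight_rev[of "xs @ [_]"] weight_rev[of xs] by simp

abbreviation window :: "int \<Rightarrow> int \<Rightarrow> nat list \<Rightarrow> 'a set" where
  "window a b xs \<equiv> {\<omega> \<in> space M. map (\<lambda>t. X t \<omega>) [a..b] = xs}"

lemma window_events [measurable]: "window a b xs \<in> events"
  by (rule sets_Collect_map_eq) simp

lemma X_start_prob: "prob {\<omega> \<in> space M. X t\<^sub>0 \<omega> = x} = pmf (\<mu> \<theta>) x"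
proof -
  have "measure (distr M (count_space UNIV) (X t\<^sub>0)) {x} = pmf (\<mu> \<theta>) x"
    by (simp add: X_start measure_pmf_single)
  then show ?thesis
    by (simp add: measure_distr vimage_def Int_def conj_commute)
qed

lemma \<zeta>_prob: "t \<noteq> t\<^sub>0 \<Longrightarrow> prob {\<omega> \<in> space M. \<zeta> t \<omega> = w} = pmf (\<mu> ((1 - \<rho>) * \<theta>)) w"
proof -
  assume "t \<noteq> t\<^sub>0"
  then have "measure (distr M (count_space UNIV) (\<zeta> t)) {w} = pmf (\<mu> ((1 - \<rho>) * \<theta>)) w"
    by (simp add: \<zeta>_distr measure_pmf_single)
  then show ?thesis
    by (simp add: measure_distr vimage_def Int_def conj_commute)
qed

text \<open>\<open>H\<close> is the history that conditions \<open>\<xi> t\<close>, and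
  \<open>H'\<close> also contains \<open>\<xi> t\<close>; so the intersection of \<open>S\<close>
  with a level set of \<open>\<xi> t\<close> is an event of \<open>H'\<close>, to which independence
  of \<open>\<zeta> t\<close> applies. Both directions of time use this form.\<close>

lemma \<zeta>_independent:
  assumes indep: "indep_set (sets (nat_sigma M {\<zeta> t})) (sets (nat_sigma M H'))"
    and "H \<subseteq> H'" "\<xi> t \<in> H'" "S \<in> sets (nat_sigma M H)" "t \<noteq> t\<^sub>0"
  shows "prob (S \<inter> {\<omega> \<in> space M. \<xi> t \<omega> = z} \<inter> {\<omega> \<in> space M. \<zeta> t \<omega> = w}) =
    prob (S \<inter> {\<omega> \<in> space M. \<xi> t \<omega> = z}) * pmf (\<mu> ((1 - \<rho>) * \<theta>)) w"
proof -
  have [measurable]: "\<xi> t \<in> measurable (nat_sigma M H') (count_space UNIV)"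
      "\<zeta> t \<in> measurable (nat_sigma M {\<zeta> t}) (count_space UNIV)"
    using assms by (auto intro: measurable_nat_sigma)
  have "{\<omega> \<in> space (nat_sigma M H'). \<xi> t \<omega> = z} \<in> sets (nat_sigma M H')"
    by measurable
  then have 1: "S \<inter> {\<omega> \<in> space M. \<xi> t \<omega> = z} \<in> sets (nat_sigma M H')"
    using assms gen_sigma_mono[of H H' M "count_space UNIV"] by auto
  have "{\<omega> \<in> space (nat_sigma M {\<zeta> t}). \<zeta> t \<omega> = w} \<in> sets (nat_sigma M {\<zeta> t})"
    by measurable
  then have 2: "{\<omega> \<in> space M. \<zeta> t \<omega> = w} \<in> sets (nat_sigma M {\<zeta> t})"
    by simp
  show ?thesis
    using indep_setD[OF indep 2 1] \<zeta>_prob[OF \<open>t \<noteq> t\<^sub>0\<close>] by (simp add: Int_commute mult.commute)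
qed

lemma forward_law:
  "prob (window t\<^sub>0 (t\<^sub>0 + int (length ys)) (x # ys)) = weight (x # ys)"
proof -
  let ?t = "\<lambda>n. t\<^sub>0 + 1 + int n"
  let ?H = "\<lambda>t. X ` {t\<^sub>0..<t} \<union> \<xi> ` {t\<^sub>0<..<t} \<union> \<zeta> ` {t\<^sub>0<..<t}"
  let ?H' = "\<lambda>t. X ` {t\<^sub>0..<t} \<union> \<xi> ` {t\<^sub>0<..t} \<union> \<zeta> ` {t\<^sub>0<..<t}"
  have "prob {\<omega> \<in> space M. map (\<lambda>i. X (t\<^sub>0 + int i) \<omega>) [0..<Suc (length ys)] = x # ys} =
      pmf (\<mu> \<theta>) x * path_weight kernel x ys"
  proof (rule chain_law[where \<xi> = "\<lambda>n. \<xi> (?t n)" and \<zeta> = "\<lambda>n. \<zeta> (?t n)" and F = "\<lambda>n. nat_sigma M (?H (?t n))"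
        and \<kappa> = "thinning_pmf \<mu> \<theta> \<rho>" and r = "\<mu> ((1 - \<rho>) * \<theta>)"])
    show "subalgebra M (nat_sigma M (?H (?t n)))" for n
      by (rule subalgebra_gen_sigma) auto
    show "X (t\<^sub>0 + int i) \<in> measurable (nat_sigma M (?H (?t n))) (count_space UNIV)" if "i \<le> n" for i n
      using that by (intro measurable_nat_sigma) auto
    show "X (t\<^sub>0 + int (Suc n)) \<omega> = \<xi> (?t n) \<omega> + \<zeta> (?t n) \<omega>" if "\<omega> \<in> space M" for n \<omega>
      using X_step[of "?t n" \<omega>] that by (simp add: add.assoc)
    show "AE \<omega> in M. cond_pr M (nat_sigma M (?H (?t n))) {\<omega> \<in> space M. \<xi> (?t n) \<omega> = z} \<omega> =
        pmf (thinning_pmf \<mu> \<theta> \<rho> (X (t\<^sub>0 + int n) \<omega>)) z" for n z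
      using \<xi>_forward[of "?t n" z] by simp
    show "prob (S \<inter> {\<omega> \<in> space M. \<xi> (?t n) \<omega> = z} \<inter> {\<omega> \<in> space M. \<zeta> (?t n) \<omega> = w}) =
        prob (S \<inter> {\<omega> \<in> space M. \<xi> (?t n) \<omega> = z}) * pmf (\<mu> ((1 - \<rho>) * \<theta>)) w"
      if "S \<in> sets (nat_sigma M (?H (?t n)))" for S n z w
      using that by (intro \<zeta>_independent[OF \<zeta>_forward[of "?t n"], of "?H (?t n)"]) auto
  qed (auto simp: X_start_prob kernel_eq_thinning)
  then show ?thesis
    unfolding upto_conv_map_upt by (simp add: weight_def o_def del: upt_Suc)
qed

lemma backward_law:
  "prob (window (t\<^sub>0 - int (length ys)) t\<^sub>0 (rev (x # ys))) = weight (x # ys)"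
proof -
  let ?t = "\<lambda>n. t\<^sub>0 - 1 - int n"
  let ?H = "\<lambda>t. X ` {t<..t\<^sub>0} \<union> \<xi> ` {t<..<t\<^sub>0} \<union> \<zeta> ` {t<..<t\<^sub>0}"
  have "prob {\<omega> \<in> space M. map (\<lambda>i. X (t\<^sub>0 - int i) \<omega>) [0..<Suc (length ys)] = x # ys} =
      pmf (\<mu> \<theta>) x * path_weight kernel x ys"
  proof (rule chain_law[where \<xi> = "\<lambda>n. \<xi> (?t n)" and \<zeta> = "\<lambda>n. \<zeta> (?t n)" and F = "\<lambda>n. nat_sigma M (?H (?t n))"
        and \<kappa> = "thinning_pmf \<mu> \<theta> \<rho>" and r = "\<mu> ((1 - \<rho>) * \<theta>)"])
    show "subalgebra M (nat_sigma M (?H (?t n)))" for n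
      by (rule subalgebra_gen_sigma) auto
    show "X (t\<^sub>0 - int i) \<in> measurable (nat_sigma M (?H (?t n))) (count_space UNIV)" if "i \<le> n" for i n
      using that by (intro measurable_nat_sigma) auto
    show "X (t\<^sub>0 - int (Suc n)) \<omega> = \<xi> (?t n) \<omega> + \<zeta> (?t n) \<omega>" if "\<omega> \<in> space M" for n \<omega>
      using X_step[of "?t n" \<omega>] that by (simp add: algebra_simps)
    show "AE \<omega> in M. cond_pr M (nat_sigma M (?H (?t n))) {\<omega> \<in> space M. \<xi> (?t n) \<omega> = z} \<omega> =
        pmf (thinning_pmf \<mu> \<theta> \<rho> (X (t\<^sub>0 - int n) \<omega>)) z" for n z
      using \<xi>_backward[of "?t n" z] by simp
    show "prob (S \<inter> {\<omega> \<in> space M. \<xi> (?t n) \<omega> = z} \<inter> {\<omega> \<in> space M. \<zeta> (?t n) \<omega> = w}) =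
        prob (S \<inter> {\<omega> \<in> space M. \<xi> (?t n) \<omega> = z}) * pmf (\<mu> ((1 - \<rho>) * \<theta>)) w"
      if "S \<in> sets (nat_sigma M (?H (?t n)))" for S n z w
      using that by (intro \<zeta>_independent[OF \<zeta>_backward[of "?t n"], of "?H (?t n)"]) auto
  qed (auto simp: X_start_prob kernel_eq_thinning)
  moreover have "map (\<lambda>t. X t \<omega>) [t\<^sub>0 - int (length ys)..t\<^sub>0] = rev (x # ys) \<longleftrightarrow>
      map (\<lambda>i. X (t\<^sub>0 - int i) \<omega>) [0..<Suc (length ys)] = x # ys" for \<omega>
  proof -
    have "map (\<lambda>t. X t \<omega>) [t\<^sub>0 - int (length ys)..t\<^sub>0] = rev (x # ys) \<longleftrightarrow>
        map (\<lambda>t. X t \<omega>) (rev [t\<^sub>0 - int (length ys)..t\<^sub>0]) = x # ys"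
      unfolding rev_map[symmetric] by (metis rev_rev_ident)
    then show ?thesis
      unfolding rev_upto_conv_map_upt by (simp add: o_def del: upt_Suc)
  qed
  ultimately show ?thesis
    by (simp add: weight_def)
qed

lemma two_sided_law:
  "prob (window (t\<^sub>0 - int (length ys)) (t\<^sub>0 + int (length zs)) (rev ys @ x # zs)) = weight (rev ys @ x # zs)"
proof -
  define a b where ab: "a = t\<^sub>0 - int (length ys)" "b = t\<^sub>0 + int (length zs)"
  define A where "A = window (t\<^sub>0 + 1) b zs"
  define B where "B = window a (t\<^sub>0 - 1) (rev ys)"
  define E where "E = {\<omega> \<in> space M. X t\<^sub>0 \<omega> = x}"
  have split_a: "[a..t\<^sub>0] = [a..t\<^sub>0 - 1] @ [t\<^sub>0]" and split_b: "[t\<^sub>0..b] = t\<^sub>0 # [t\<^sub>0 + 1..b]"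
    and split: "[a..b] = [a..t\<^sub>0 - 1] @ t\<^sub>0 # [t\<^sub>0 + 1..b]"
    using upto_rec2[of a t\<^sub>0] upto_rec1[of t\<^sub>0 b] upto_split3[of a t\<^sub>0 b] by (auto simp: ab)
  have len: "length [a..t\<^sub>0 - 1] = length ys" by (simp add: ab)
  have EA: "A \<inter> E = window t\<^sub>0 b (x # zs)"
    by (auto simp: A_def E_def split_b)
  have EB: "B \<inter> E = window a t\<^sub>0 (rev (x # ys))"
    by (auto simp: B_def E_def split_a)
  have EAB: "A \<inter> B \<inter> E = window a b (rev ys @ x # zs)"
    using len by (auto simp: A_def B_def E_def split append_eq_append_conv)
  have [measurable]: "A \<in> events" "B \<in> events" by (auto simp: A_def B_def)
  have pE: "prob E = pmf (\<mu> \<theta>) x" by (simp add: E_def X_start_prob)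
  have "A \<in> sets (nat_sigma M (X ` {t\<^sub>0<..} \<union> \<xi> ` {t\<^sub>0<..} \<union> \<zeta> ` {t\<^sub>0<..}))" (is "_ \<in> sets ?N")
  proof -
    have "{\<omega> \<in> space ?N. map (\<lambda>t. X t \<omega>) [t\<^sub>0 + 1..b] = zs} \<in> sets ?N"
      by (rule sets_Collect_map_eq) (auto intro: measurable_nat_sigma)
    then show ?thesis by (simp add: A_def)
  qed
  moreover have "B \<in> sets (nat_sigma M (X ` {..<t\<^sub>0} \<union> \<xi> ` {..<t\<^sub>0} \<union> \<zeta> ` {..<t\<^sub>0}))" (is "_ \<in> sets ?N")
  proof -
    have "{\<omega> \<in> space ?N. map (\<lambda>t. X t \<omega>) [a..t\<^sub>0 - 1] = rev ys} \<in> sets ?N"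
      by (rule sets_Collect_map_eq) (auto intro: measurable_nat_sigma)
    then show ?thesis by (simp add: B_def)
  qed
  ultimately have "AE \<omega> in M. cond_pr M (nat_sigma M {X t\<^sub>0}) (A \<inter> B) \<omega> =
      cond_pr M (nat_sigma M {X t\<^sub>0}) A \<omega> * cond_pr M (nat_sigma M {X t\<^sub>0}) B \<omega>"
    by (rule forward_backward)
  moreover have "AE \<omega> in M. cond_pr M (nat_sigma M {X t\<^sub>0}) C \<omega> =
      prob (C \<inter> {\<omega>' \<in> space M. X t\<^sub>0 \<omega>' = X t\<^sub>0 \<omega>}) / pmf (\<mu> \<theta>) (X t\<^sub>0 \<omega>)" if "C \<in> events" for C
    using cond_pr_discrete[OF X_measurable[of t\<^sub>0] that] start_pos by (simp add: X_start_prob)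
  note this[of "A \<inter> B"] this[of A] this[of B]
  \<comment> \<open>On \<open>E\<close> all three conditional probabilities are constants. Since
    \<open>E\<close> is not a null set, the almost sure identity becomes an identity between
    numbers.\<close>
  ultimately have "AE \<omega> in M. \<omega> \<in> E \<longrightarrow>
      prob (A \<inter> B \<inter> E) / prob E = (prob (A \<inter> E) / prob E) * (prob (B \<inter> E) / prob E)"
    by (force simp: E_def X_start_prob)
  moreover have "\<not> (AE \<omega> in M. \<omega> \<notin> E)"
  proof
    assume "AE \<omega> in M. \<omega> \<notin> E"
    then have "prob E = prob {}"
      by (intro finite_measure_eq_AE) (auto simp: E_def)
    then show False using pE start_pos[of x] by simp
  qed
  ultimately have "prob (A \<inter> B \<inter> E) / prob E = (prob (A \<inter> E) / prob E) * (prob (B \<inter> E) / prob E)"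
    by (metis (mono_tags, lifting) AE_mp AE_I2)
  then have "prob (A \<inter> B \<inter> E) * prob E = prob (A \<inter> E) * prob (B \<inter> E)"
    using pE start_pos[of x] by (simp add: field_simps)
  then have "prob (window a b (rev ys @ x # zs)) * pmf (\<mu> \<theta>) x = weight (x # zs) * weight (x # ys)"
    unfolding EA EB EAB pE using forward_law[of zs x] backward_law[of ys x] by (simp add: ab)
  then show ?thesis
    using start_pos[of x] unfolding weight_rev_append ab by (simp add: weight_def)
qed

text \<open>Summing out the state at either end of a window; this is how windows that miss
  \<open>t\<^sub>0\<close> are reached from those that contain it.\<close>

lemma window_prob_take:
  assumes le: "a \<le> b"
    and law: "\<And>xs. length xs = nat (b - a + 1) \<Longrightarrow> prob (window a b xs) = weight xs"
    and len: "length xs = nat (b - a)"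
  shows "prob (window a (b - 1) xs) = weight xs" "prob (window (a + 1) b xs) = weight xs"
proof -
  have "(\<lambda>y. prob (window a b (xs @ [y]))) sums prob (\<Union>y. window a b (xs @ [y]))"
    by (rule finite_measure_UNION) (auto simp: disjoint_family_on_def)
  also have "(\<Union>y. window a b (xs @ [y])) = window a (b - 1) xs"
    using upto_rec2[OF le] by auto
  finally have "(\<lambda>y. weight (xs @ [y])) sums prob (window a (b - 1) xs)"
    using le len by (simp add: law nat_add_distrib)
  then show "prob (window a (b - 1) xs) = weight xs"
    using weight_snoc_sums sums_unique2 by blast
  have "(\<lambda>y. prob (window a b (y # xs))) sums prob (\<Union>y. window a b (y # xs))"
    by (rule finite_measure_UNION) (auto simp: disjoint_family_on_def)
  also have "(\<Union>y. window a b (y # xs)) = window (a + 1) b xs"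
    using upto_rec1[OF le] by auto
  finally have "(\<lambda>y. weight (y # xs)) sums prob (window (a + 1) b xs)"
    using le len by (simp add: law nat_add_distrib)
  then show "prob (window (a + 1) b xs) = weight xs"
    using weight_Cons_sums sums_unique2 by blast
qed

lemma window_prob_around_start:
  assumes "a \<le> t\<^sub>0" "t\<^sub>0 \<le> b" "length xs = nat (b - a + 1)"
  shows "prob (window a b xs) = weight xs"
proof -
  define n where "n = nat (t\<^sub>0 - a)"
  have n: "n < length xs" using assms by (simp add: n_def)
  have xs: "xs = rev (rev (take n xs)) @ xs ! n # drop (Suc n) xs"
    using id_take_nth_drop[OF n] by simp
  have "a = t\<^sub>0 - int (length (rev (take n xs)))" "b = t\<^sub>0 + int (length (drop (Suc n) xs))"
    using assms n by (auto simp: n_def)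
  then show ?thesis
    using two_sided_law[of "rev (take n xs)" "drop (Suc n) xs" "xs ! n"] xs by simp
qed

lemma window_prob:
  assumes "a \<le> b" "length xs = nat (b - a + 1)"
  shows "prob (window a b xs) = weight xs"
proof -
  \<comment> \<open>The window from \<open>min a t\<^sub>0\<close> to \<open>max b t\<^sub>0\<close>
    contains the starting time. \<open>right\<close> trims it down to the end \<open>b\<close>, and
    \<open>left\<close> then trims it up to the beginning \<open>a\<close>.\<close>
  have right: "prob (window a' (b' - int n) xs) = weight xs"
    if "a' \<le> t\<^sub>0" "t\<^sub>0 \<le> b'" "int n \<le> b' - a'" "length xs = nat (b' - int n - a' + 1)" for a' b' n xs
    using that
  proof (induction n arbitrary: xs)
    case (Suc n)
    have "prob (window a' (b' - int n - 1) xs) = weight xs"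
      using Suc.prems by (intro window_prob_take(1) Suc.IH) auto
    then show ?case by (simp add: algebra_simps)
  qed (use window_prob_around_start in auto)
  have left: "prob (window (a' + int n) b xs) = weight xs"
    if "a' \<le> t\<^sub>0" "int n \<le> b - a'" "length xs = nat (b - (a' + int n) + 1)" for a' n xs
    using that
  proof (induction n arbitrary: xs)
    case 0
    have "prob (window a' (max b t\<^sub>0 - int (nat (max b t\<^sub>0 - b))) xs) = weight xs"
      using 0 by (intro right) auto
    then show ?case by simp
  next
    case (Suc n)
    have "prob (window (a' + int n + 1) b xs) = weight xs"
      using Suc.prems by (intro window_prob_take(2) Suc.IH) auto
    then show ?case by (simp add: algebra_simps)
  qed
  have "prob (window (min a t\<^sub>0 + int (nat (a - min a t\<^sub>0))) b xs) = weight xs"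
    using assms by (intro left) auto
  then show ?thesis by simp
qed

lemma X_prob: "prob {\<omega> \<in> space M. X t \<omega> = x} = pmf (\<mu> \<theta>) x"
  using window_prob[of t t "[x]"] by (simp add: weight_def)

lemma distr_pair: "distr M (count_space UNIV) (\<lambda>\<omega>. (X (t - 1) \<omega>, X t \<omega>)) = measure_pmf pair_law"
proof (rule measure_eqI_countable)
  fix z :: "nat \<times> nat"
  obtain x y where z: "z = (x, y)" by fastforce
  have "[t - 1..t] = [t - 1, t]"
    using upto_rec1[of "t - 1" t] by simp
  then have "prob {\<omega> \<in> space M. X (t - 1) \<omega> = x \<and> X t \<omega> = y} = pmf pair_law (x, y)"
    using window_prob[of "t - 1" t "[x, y]"] start_kernel by (simp add: weight_def)
  then show "emeasure (distr M (count_space UNIV) (\<lambda>\<omega>. (X (t - 1) \<omega>, X t \<omega>))) {z} =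
      emeasure (measure_pmf pair_law) {z}"
    by (simp add: z emeasure_distr emeasure_pmf_single emeasure_eq_measure vimage_def Int_def conj_commute)
qed auto

section \<open>Stationarity and time reversal\<close>

lemma distr_map_eqI:
  fixes f g :: "'a \<Rightarrow> nat list"
  assumes [measurable]: "f \<in> measurable M (count_space UNIV)" "g \<in> measurable M (count_space UNIV)"
    and "\<And>xs. prob {\<omega> \<in> space M. f \<omega> = xs} = prob {\<omega> \<in> space M. g \<omega> = xs}"
  shows "distr M (count_space UNIV) f = distr M (count_space UNIV) g"
proof (rule measure_eqI_countable)
  show "emeasure (distr M (count_space UNIV) f) {xs} = emeasure (distr M (count_space UNIV) g) {xs}" for xs
    using assms(3)[of xs] by (simp add: emeasure_distr emeasure_eq_measure vimage_def Int_def conj_commute)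
qed auto

text \<open>The map \<open>g\<close> reads the coordinates in \<open>T\<close> off the list of
  values on an enclosing interval, so finite-dimensional laws need to be compared on windows
  only.\<close>

lemma joint_law_eqI:
  assumes "T \<subseteq> {a..b}"
    and "distr M (count_space UNIV) (\<lambda>\<omega>. map (\<lambda>t. X (\<phi> t) \<omega>) [a..b]) =
      distr M (count_space UNIV) (\<lambda>\<omega>. map (\<lambda>t. X (\<psi> t) \<omega>) [a..b])"
  shows "joint_law M (\<lambda>t \<omega>. real (X t \<omega>)) T \<phi> = joint_law M (\<lambda>t \<omega>. real (X t \<omega>)) T \<psi>"
proof -
  define g where "g xs = (\<lambda>t\<in>T. real (xs ! nat (t - a)))" for xs :: "nat list"
  have g: "g \<in> measurable (count_space UNIV) (\<Pi>\<^sub>M t\<in>T. borel)"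
    by (auto simp: g_def space_PiM)
  have "joint_law M (\<lambda>t \<omega>. real (X t \<omega>)) T \<eta> =
      distr (distr M (count_space UNIV) (\<lambda>\<omega>. map (\<lambda>t. X (\<eta> t) \<omega>) [a..b])) (\<Pi>\<^sub>M t\<in>T. borel) g" for \<eta>
  proof -
    have f: "(\<lambda>\<omega>. map (\<lambda>t. X (\<eta> t) \<omega>) [a..b]) \<in> measurable M (count_space UNIV)"
      by (rule measurable_map_list) simp
    have "g \<circ> (\<lambda>\<omega>. map (\<lambda>t. X (\<eta> t) \<omega>) [a..b]) = (\<lambda>\<omega>. \<lambda>t\<in>T. real (X (\<eta> t) \<omega>))"
      using assms(1) by (auto simp: g_def fun_eq_iff restrict_def nth_upto subset_iff)
    then show ?thesis
      by (simp only: joint_law_def distr_distr[OF g f])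
  qed
  then show ?thesis by (simp add: assms(2))
qed

lemma finite_subset_interval: "finite (T :: int set) \<Longrightarrow> \<exists>a b. a \<le> b \<and> T \<subseteq> {a..b}"
proof -
  assume "finite T"
  then have "T \<subseteq> {Min (insert 0 T)..Max (insert 0 T)}" by auto
  moreover have "Min (insert 0 T) \<le> Max (insert 0 T)" using \<open>finite T\<close> by (meson Max_ge Min_le finite.insertI insertI1 order_trans)
  ultimately show ?thesis by blast
qed

lemma stationary_X: "stationary M (\<lambda>t \<omega>. real (X t \<omega>))"
  unfolding stationary_def
proof (intro allI impI)
  fix T :: "int set" and s assume "finite T"
  then obtain a b where ab: "a \<le> b" "T \<subseteq> {a..b}" using finite_subset_interval by blast
  have eq: "map (\<lambda>t. X (s + t) \<omega>) [a..b] = map (\<lambda>t. X t \<omega>) [s + a..s + b]" for \<omega>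
    by (simp add: upto_shift o_def)
  have "distr M (count_space UNIV) (\<lambda>\<omega>. map (\<lambda>t. X t \<omega>) [a..b]) =
      distr M (count_space UNIV) (\<lambda>\<omega>. map (\<lambda>t. X t \<omega>) [s + a..s + b])"
  proof (rule distr_map_eqI)
    fix xs :: "nat list"
    show "prob (window a b xs) = prob (window (s + a) (s + b) xs)"
    proof (cases "length xs = nat (b - a + 1)")
      case False
      then have "window a b xs = {}" "window (s + a) (s + b) xs = {}" by auto
      then show ?thesis by (simp only:)
    qed (use ab in \<open>simp add: window_prob\<close>)
  qed (auto intro: measurable_map_list)
  then show "joint_law M (\<lambda>t \<omega>. real (X t \<omega>)) T (\<lambda>t. t) =
      joint_law M (\<lambda>t \<omega>. real (X t \<omega>)) T (\<lambda>t. s + t)"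
    by (intro joint_law_eqI[OF ab(2)]) (simp add: eq)
qed

lemma time_reversible_X: "time_reversible M (\<lambda>t \<omega>. real (X t \<omega>))"
  unfolding time_reversible_def
proof (intro conjI stationary_X allI impI)
  fix T :: "int set" assume "finite T"
  then obtain a b where ab: "a \<le> b" "T \<subseteq> {a..b}" using finite_subset_interval by blast
  have eq: "map (\<lambda>t. X (- t) \<omega>) [a..b] = rev (map (\<lambda>t. X t \<omega>) [- b..- a])" for \<omega>
    unfolding rev_map upto_reflect by (simp add: o_def)
  have "distr M (count_space UNIV) (\<lambda>\<omega>. map (\<lambda>t. X t \<omega>) [a..b]) =
      distr M (count_space UNIV) (\<lambda>\<omega>. map (\<lambda>t. X (- t) \<omega>) [a..b])"
  proof (rule distr_map_eqI)
    fix xs :: "nat list"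
    have "{\<omega> \<in> space M. map (\<lambda>t. X (- t) \<omega>) [a..b] = xs} = window (- b) (- a) (rev xs)"
      unfolding eq by (auto simp: rev_swap)
    moreover have "prob (window a b xs) = prob (window (- b) (- a) (rev xs))"
    proof (cases "length xs = nat (b - a + 1)")
      case False
      then have "window a b xs = {}" "window (- b) (- a) (rev xs) = {}"
        by (auto dest: arg_cong[where f = length])
      then show ?thesis by (simp only:)
    qed (use ab in \<open>simp add: window_prob weight_rev\<close>)
    ultimately show "prob (window a b xs) = prob {\<omega> \<in> space M. map (\<lambda>t. X (- t) \<omega>) [a..b] = xs}"
      by simp
  qed (auto intro: measurable_map_list)
  then show "joint_law M (\<lambda>t \<omega>. real (X t \<omega>)) T (\<lambda>t. t) = joint_law M (\<lambda>t \<omega>. real (X t \<omega>)) T (\<lambda>t. - t)"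
    by (intro joint_law_eqI[OF ab(2)])
qed

section \<open>The Markov property\<close>

text \<open>Independence of past and future given the present, for a single past and a single future
  list, with denominators cleared. The future list includes time \<open>t\<close> itself. If both
  lists are genuine and share the state \<open>x\<close> at \<open>t\<close>, the weight splits
  there; otherwise one of the two events is empty and both sides vanish.\<close>

lemma window_factor:
  assumes "a \<le> t" "t \<le> b"
  shows "prob {\<omega> \<in> space M. X t \<omega> = x} * prob {\<omega> \<in> window a t (us @ [x]). map (\<lambda>t. X t \<omega>) [t..b] = zs} =
    prob (window a t (us @ [x])) * prob {\<omega> \<in> {\<omega> \<in> space M. X t \<omega> = x}. map (\<lambda>t. X t \<omega>) [t..b] = zs}"
proof -
  have ta: "[a..t] = [a..t - 1] @ [t]" and tb: "[t..b] = t # [t + 1..b]"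
    and tab: "[a..b] = [a..t - 1] @ t # [t + 1..b]"
    using assms upto_rec2[of a t] upto_rec1[of t b] upto_split3[of a t b] by auto
  have in_tail: "\<exists>ys. zs = x # ys \<and> length ys = nat (b - t)"
    if "\<omega> \<in> {\<omega> \<in> space M. X t \<omega> = x}" "map (\<lambda>t. X t \<omega>) [t..b] = zs" for \<omega>
    using that by (intro exI[of _ "map (\<lambda>t. X t \<omega>) [t + 1..b]"]) (simp add: tb)
  have in_window: "length us = nat (t - a) \<and> \<omega> \<in> {\<omega> \<in> space M. X t \<omega> = x}" if "\<omega> \<in> window a t (us @ [x])" for \<omega>
    using that by (auto simp: ta dest: arg_cong[where f = length])
  consider ys where "zs = x # ys" "length us = nat (t - a)" "length ys = nat (b - t)"
    | "window a t (us @ [x]) = {}" | "{\<omega> \<in> {\<omega> \<in> space M. X t \<omega> = x}. map (\<lambda>t. X t \<omega>) [t..b] = zs} = {}"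
      "{\<omega> \<in> window a t (us @ [x]). map (\<lambda>t. X t \<omega>) [t..b] = zs} = {}"
  proof (cases "{\<omega> \<in> {\<omega> \<in> space M. X t \<omega> = x}. map (\<lambda>t. X t \<omega>) [t..b] = zs} = {}")
    case True
    moreover from this have "{\<omega> \<in> window a t (us @ [x]). map (\<lambda>t. X t \<omega>) [t..b] = zs} = {}"
      using in_window by fast
    ultimately show ?thesis by (rule that(3))
  next
    case False
    then obtain \<omega> where "\<omega> \<in> {\<omega> \<in> space M. X t \<omega> = x}" "map (\<lambda>t. X t \<omega>) [t..b] = zs" by blast
    from in_tail[OF this] obtain ys where "zs = x # ys" "length ys = nat (b - t)" by blast
    then show ?thesis using that(1,2) in_window by fast
  qed
  then show ?thesis
  proof cases
    case 1
    then have "{\<omega> \<in> window a t (us @ [x]). map (\<lambda>t. X t \<omega>) [t..b] = zs} = window a b (us @ x # ys)"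
      by (auto simp: ta tb tab append_eq_append_conv)
    moreover have "{\<omega> \<in> {\<omega> \<in> space M. X t \<omega> = x}. map (\<lambda>t. X t \<omega>) [t..b] = zs} = window t b (x # ys)"
      using 1 by (auto simp: tb)
    moreover have "prob (window a b (us @ x # ys)) = weight (us @ [x]) * path_weight kernel x ys"
      unfolding weight_append[symmetric] using 1 assms by (intro window_prob) auto
    moreover have "prob (window t b (x # ys)) = pmf (\<mu> \<theta>) x * path_weight kernel x ys"
      using 1 assms window_prob[of t b "x # ys"] by (simp add: weight_def)
    moreover have "prob (window a t (us @ [x])) = weight (us @ [x])"
      using 1 assms by (intro window_prob) auto
    ultimately show ?thesis by (simp only: X_prob mult_ac)
  next
    case 2
    then have "{\<omega> \<in> window a t (us @ [x]). map (\<lambda>t. X t \<omega>) [t..b] = zs} = {}" by blast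
    with 2 show ?thesis by (simp only: measure_empty mult_zero_right mult_zero_left)
  next
    case 3
    then show ?thesis by (simp only: measure_empty mult_zero_right)
  qed
qed

lemma markov_X: "markov M (\<lambda>t \<omega>. real (X t \<omega>))"
  unfolding markov_def
proof (intro allI impI ballI)
  fix t :: int and T :: "int set" and B
  assume T: "T \<subseteq> {t..}" "finite T" and B: "B \<in> sets (\<Pi>\<^sub>M s\<in>T. (borel :: real measure))"
  obtain a' b' where "T \<subseteq> {a'..b'}" using finite_subset_interval[OF T(2)] by blast
  then obtain b where b: "t \<le> b" "T \<subseteq> {t..b}"
    using T(1) by (intro that[of "max t b'"]) (auto simp: subset_iff le_max_iff_disj)
  define C where "C = {\<omega> \<in> space M. (\<lambda>s\<in>T. real (X s \<omega>)) \<in> B}"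
  define L where "L = {xs :: nat list. (\<lambda>s\<in>T. real (xs ! nat (s - t))) \<in> B}"
  have list [measurable]: "(\<lambda>\<omega>. map (\<lambda>t. X t \<omega>) [a..b]) \<in> measurable M (count_space UNIV)" for a b
    by (rule measurable_map_list) simp
  have "(\<lambda>s\<in>T. real (map (\<lambda>t. X t \<omega>) [t..b] ! nat (s - t))) = (\<lambda>s\<in>T. real (X s \<omega>))" for \<omega>
    using b(2) by (auto simp: fun_eq_iff restrict_def nth_upto subset_iff)
  then have CL: "C = {\<omega> \<in> space M. map (\<lambda>t. X t \<omega>) [t..b] \<in> L}"
    by (simp add: C_def L_def)
  have C [measurable]: "C \<in> events"
    using measurable_sets[OF list, of L t b] by (simp add: CL vimage_def Int_def conj_commute)
  let ?F = "nat_sigma M (X ` {..t})"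
  \<comment> \<open>Of two windows ending at \<open>t\<close> the longer determines the shorter, so
    they intersect in the longer one or not at all. Below, \<open>window t t []\<close> stands for
    the empty set: a one-point window never shows the empty list.\<close>
  let ?G = "{window a t xs | a xs. a \<le> t}"
  have "AE \<omega> in M. cond_pr M ?F C \<omega> =
      prob (C \<inter> {\<omega>' \<in> space M. X t \<omega>' = X t \<omega>}) / prob {\<omega>' \<in> space M. X t \<omega>' = X t \<omega>}"
  proof (rule cond_pr_eqI)
    show "subalgebra M ?F" by (rule subalgebra_gen_sigma) auto
    show "X t \<in> measurable ?F (count_space UNIV)" by (rule measurable_nat_sigma) auto
    have *: "window a t xs \<inter> window a' t ys \<in> ?G" if "a \<le> a'" "a' \<le> t" for a a' xs ys
    proof -
      have "[a..t] = [a..a' - 1] @ [a'..t]" using that upto_split1[of a a' t] by simp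
      then have "map (\<lambda>t. X t \<omega>) [a'..t] = drop (nat (a' - a)) (map (\<lambda>t. X t \<omega>) [a..t])" for \<omega>
        using that by simp
      then have "window a t xs \<inter> window a' t ys = (if ys = drop (nat (a' - a)) xs then window a t xs else window t t [])"
        by auto
      moreover have "window a t xs \<in> ?G" "window t t [] \<in> ?G" using order_trans[OF that] by blast+
      ultimately show ?thesis by simp
    qed
    show "Int_stable ?G"
    proof (rule Int_stableI)
      fix S S' assume "S \<in> ?G" "S' \<in> ?G"
      then obtain a xs a' ys where "S = window a t xs" "a \<le> t" "S' = window a' t ys" "a' \<le> t" by blast
      then show "S \<inter> S' \<in> ?G" using *[of a a' xs ys] *[of a' a ys xs] by (cases "a \<le> a'") (auto simp: Int_commute)
    qed
    show "?G \<subseteq> events" by auto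
    show "sets ?F \<subseteq> sigma_sets (space M) ?G"
      unfolding sets_gen_sigma
    proof (intro sigma_sets_mono subsetI)
      fix S assume "S \<in> {f -` B \<inter> space M | f B. f \<in> X ` {..t} \<and> B \<in> sets (count_space UNIV)}"
      then obtain s B where s: "s \<le> t" and S: "S = X s -` B \<inter> space M" by auto
      have "S = (\<Union>xs\<in>{xs. hd xs \<in> B}. window s t xs)"
        using upto_rec1[OF s] by (auto simp: S)
      moreover have "\<dots> \<in> sigma_sets (space M) ?G"
        using s by (intro sigma_sets_UNION) (auto intro!: sigma_sets.Basic)
      ultimately show "S \<in> sigma_sets (space M) ?G" by simp
    qed
    show "\<exists>x. (\<forall>\<omega>\<in>S. X t \<omega> = x) \<and>
        prob (S \<inter> C) * prob {\<omega> \<in> space M. X t \<omega> = x} = prob S * prob (C \<inter> {\<omega> \<in> space M. X t \<omega> = x})"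
      if S: "S \<in> ?G" "S \<noteq> {}" for S
    proof -
      obtain a xs where a: "a \<le> t" and "S = window a t xs" using S by blast
      moreover from this have "xs \<noteq> []" using S(2) by auto
      ultimately obtain us x where Sx: "S = window a t (us @ [x])" by (metis rev_exhaust)
      have "\<forall>\<omega>\<in>S. X t \<omega> = x"
        using upto_rec2[OF a] by (simp add: Sx)
      moreover have "prob {\<omega> \<in> space M. X t \<omega> = x} * prob {\<omega> \<in> S. map (\<lambda>t. X t \<omega>) [t..b] \<in> L} =
          prob S * prob {\<omega> \<in> {\<omega> \<in> space M. X t \<omega> = x}. map (\<lambda>t. X t \<omega>) [t..b] \<in> L}"
        unfolding Sx using a b(1) by (intro measure_vimage_eq_from_points window_factor list) auto
      moreover have "{\<omega> \<in> S. map (\<lambda>t. X t \<omega>) [t..b] \<in> L} = S \<inter> C"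
        by (auto simp: CL Sx)
      moreover have "{\<omega> \<in> {\<omega> \<in> space M. X t \<omega> = x}. map (\<lambda>t. X t \<omega>) [t..b] \<in> L} = C \<inter> {\<omega> \<in> space M. X t \<omega> = x}"
        by (auto simp: CL)
      ultimately show ?thesis by (intro exI[of _ x]) (simp only: mult.commute simp_thms)
    qed
  qed (auto simp: X_prob start_pos)
  moreover have "AE \<omega> in M. cond_pr M (nat_sigma M {X t}) C \<omega> =
      prob (C \<inter> {\<omega>' \<in> space M. X t \<omega>' = X t \<omega>}) / prob {\<omega>' \<in> space M. X t \<omega>' = X t \<omega>}"
    by (rule cond_pr_discrete) (auto simp: X_prob start_pos)
  moreover have "gen_sigma M borel ((\<lambda>t \<omega>. real (X t \<omega>)) ` {..t}) = ?F"
    using gen_sigma_real[of M "X ` {..t}"] by (simp add: image_image)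
  moreover have "gen_sigma M borel {\<lambda>\<omega>. real (X t \<omega>)} = nat_sigma M {X t}"
    using gen_sigma_real[of M "{X t}"] by simp
  ultimately show "AE \<omega> in M. cond_pr M (gen_sigma M borel ((\<lambda>t \<omega>. real (X t \<omega>)) ` {..t}))
        {\<omega> \<in> space M. (\<lambda>s\<in>T. real (X s \<omega>)) \<in> B} \<omega> =
      cond_pr M (gen_sigma M borel {\<lambda>\<omega>. real (X t \<omega>)}) {\<omega> \<in> space M. (\<lambda>s\<in>T. real (X s \<omega>)) \<in> B} \<omega>"
    by (force simp: C_def)
qed

end

section \<open>Compound Poisson laws\<close>

text \<open>Each nonzero integer triple excludes the finitely many roots of one polynomial, and
  there are only countably many triples. The result is an additive injection of integer triples into
  the reals, which reduces uniqueness of characteristic functions in three dimensions to the real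
  line.\<close>

lemma quadratic_relation_free: "\<exists>w::real. inj (\<lambda>(a::int, b::int, c::int). of_int a + of_int b * w + of_int c * w\<^sup>2)"
proof -
  define bad where "bad z = (case z of (a::int, b::int, c::int) \<Rightarrow> {w::real. of_int a + of_int b * w + of_int c * w\<^sup>2 = 0})" for z
  have "finite (bad z)" if z: "z \<noteq> (0, 0, 0)" for z
  proof -
    obtain a b c where abc: "z = (a, b, c)" by (cases z)
    have "bad z = {w. poly [:of_int a, of_int b, of_int c:] w = 0}"
      by (auto simp: abc bad_def power2_eq_square algebra_simps)
    moreover have "[:of_int a, of_int b, of_int c:] \<noteq> (0 :: real poly)"
      using z abc by simp
    ultimately show ?thesis using poly_roots_finite by metis
  qed
  then have "countable (\<Union>z\<in>- {(0, 0, 0)}. bad z)"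
    by (intro countable_UN countableI_type) (auto intro: countable_finite)
  then have "(\<Union>z\<in>- {(0, 0, 0)}. bad z) \<noteq> UNIV"
    using uncountable_UNIV_real by metis
  then obtain w where w: "\<And>z. z \<noteq> (0, 0, 0) \<Longrightarrow> w \<notin> bad z" by blast
  have "inj (\<lambda>(a::int, b::int, c::int). of_int a + of_int b * w + of_int c * w\<^sup>2)"
  proof (rule injI)
    fix z z' :: "int \<times> int \<times> int"
    assume eq: "(\<lambda>(a, b, c). of_int a + of_int b * w + of_int c * w\<^sup>2) z =
      (\<lambda>(a, b, c). of_int a + of_int b * w + of_int c * w\<^sup>2) z'"
    obtain a b c a' b' c' where z: "z = (a, b, c)" "z' = (a', b', c')" by (metis prod_cases3)
    with eq have "w \<in> bad (a - a', b - b', c - c')"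
      by (simp add: bad_def algebra_simps)
    then show "z = z'" using w[of "(a - a', b - b', c - c')"] by (auto simp: z)
  qed
  then show ?thesis by blast
qed

text \<open>Levy's uniqueness theorem is applied to the images under \<open>h\<close>; injectivity
  recovers each atom from its image.\<close>

lemma pmf_char_unique:
  fixes h :: "'b \<Rightarrow> real"
  assumes "inj h" and eq: "\<And>s. (CLINT x|measure_pmf p. iexp (s * h x)) = (CLINT x|measure_pmf q. iexp (s * h x))"
  shows "p = q"
proof (rule pmf_eqI)
  fix x
  have real: "real_distribution (distr (measure_pmf p) borel h)" for p
    by (intro prob_space.real_distribution_distr measure_pmf.prob_space_axioms) simp
  have "char (distr (measure_pmf p) borel h) = char (distr (measure_pmf q) borel h)"
  proof
    show "char (distr (measure_pmf p) borel h) s = char (distr (measure_pmf q) borel h) s" for s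
      using eq[of s] by (simp add: char_def integral_distr)
  qed
  then have "distr (measure_pmf p) borel h = distr (measure_pmf q) borel h"
    by (intro Levy_uniqueness real)
  then have "measure (distr (measure_pmf p) borel h) {h x} = measure (distr (measure_pmf q) borel h) {h x}"
    by simp
  moreover have "h -` {h x} = {x}" using \<open>inj h\<close> by (auto simp: inj_def)
  ultimately show "pmf p x = pmf q x"
    by (simp add: measure_distr measure_pmf_single)
qed

lemma pmf_weighted_sums:
  fixes g :: "nat \<Rightarrow> 'b::{banach, second_countable_topology}"
  assumes "\<And>n. norm (g n) \<le> B"
  shows "(\<lambda>n. pmf p n *\<^sub>R g n) sums (LINT n|measure_pmf p. g n)"
proof -
  have "integrable (measure_pmf p) g"
    by (rule measure_pmf.integrable_const_bound[where B = B]) (auto simp: assms)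
  then have "integrable (count_space UNIV) (\<lambda>n. pmf p n *\<^sub>R g n)"
    unfolding measure_pmf_eq_density by (subst (asm) integrable_density) auto
  then have "(\<lambda>n. pmf p n *\<^sub>R g n) sums (LINT n|count_space UNIV. pmf p n *\<^sub>R g n)"
    by (rule sums_integral_count_space_nat)
  also have "(LINT n|count_space UNIV. pmf p n *\<^sub>R g n) = (LINT n|measure_pmf p. g n)"
    unfolding measure_pmf_eq_density by (subst integral_density) auto
  finally show ?thesis .
qed

section \<open>Compound Poisson laws and their characteristic functions\<close>

primrec iid_sum :: "'b::comm_monoid_add pmf \<Rightarrow> nat \<Rightarrow> 'b pmf" where
  "iid_sum \<kappa> 0 = return_pmf 0"
| "iid_sum \<kappa> (Suc n) = map_pmf (\<lambda>(x, y). x + y) (pair_pmf \<kappa> (iid_sum \<kappa> n))"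

definition compound_poisson :: "real \<Rightarrow> 'b::comm_monoid_add pmf \<Rightarrow> 'b pmf" where
  "compound_poisson r \<kappa> = bind_pmf (poisson_pmf r) (iid_sum \<kappa>)"

lemma integral_bind_pmf_bounded:
  fixes f :: "'b \<Rightarrow> complex"
  assumes B: "\<And>x. norm (f x) \<le> B"
  shows "(LINT x|measure_pmf (bind_pmf p N). f x) = (LINT y|measure_pmf p. LINT x|measure_pmf (N y). f x)"
proof -
  have real: "(LINT x|measure_pmf (bind_pmf p N). g x) = (LINT y|measure_pmf p. LINT x|measure_pmf (N y). g x)"
    if "\<And>x. \<bar>g x\<bar> \<le> B" for g :: "'b \<Rightarrow> real"
    unfolding measure_pmf_bind using that measurable_measure_pmf[of N]
    by (intro integral_bind[where B' = 1 and K = "count_space UNIV" and B = B])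
       (auto simp: measure_pmf.finite_measure_axioms measure_pmf.emeasure_space_1[simplified])
  have f: "integrable (measure_pmf q) f" for q
    using B by (intro measure_pmf.integrable_const_bound[where B = B]) auto
  have "norm (LINT x|measure_pmf (N y). f x) \<le> B" for y
  proof -
    have "norm (LINT x|measure_pmf (N y). f x) \<le> (LINT x|measure_pmf (N y). norm (f x))"
      by (rule integral_norm_bound)
    also have "\<dots> \<le> B"
      using f B by (intro measure_pmf.integral_le_const) auto
    finally show ?thesis .
  qed
  then have int: "integrable (measure_pmf p) (\<lambda>y. LINT x|measure_pmf (N y). f x)"
    by (intro measure_pmf.integrable_const_bound[where B = B]) auto
  have "\<bar>Re (f x)\<bar> \<le> B" "\<bar>Im (f x)\<bar> \<le> B" for x
    using B[of x] abs_Re_le_cmod[of "f x"] abs_Im_le_cmod[of "f x"] by linarith+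
  then show ?thesis
    using real[of "\<lambda>x. Re (f x)"] real[of "\<lambda>x. Im (f x)"] f int
    by (intro complex_eqI) (simp_all flip: integral_Re integral_Im)
qed

lemma char_convolution:
  fixes h :: "'b::comm_monoid_add \<Rightarrow> real"
  assumes h: "\<And>x y. h (x + y) = h x + h y"
  shows "(CLINT x|measure_pmf (map_pmf (\<lambda>(x, y). x + y) (pair_pmf p q)). iexp (s * h x)) =
    (CLINT x|measure_pmf p. iexp (s * h x)) * (CLINT x|measure_pmf q. iexp (s * h x))"
proof -
  have "(CLINT x|measure_pmf (map_pmf (\<lambda>(x, y). x + y) (pair_pmf p q)). iexp (s * h x)) =
      (CLINT z|measure_pmf (pair_pmf p q). iexp (s * h (fst z)) * iexp (s * h (snd z)))"
    by (simp add: case_prod_beta h algebra_simps flip: exp_add)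
  also have "\<dots> = (CLINT x|measure_pmf p. CLINT y|measure_pmf q. iexp (s * h x) * iexp (s * h y))"
    unfolding pair_pmf_def
    by (subst integral_bind_pmf_bounded[where B = 1]; (subst integral_bind_pmf_bounded[where B = 1])?)
       (auto simp: norm_mult)
  finally show ?thesis by simp
qed

lemma char_iid_sum:
  fixes h :: "'b::comm_monoid_add \<Rightarrow> real"
  assumes "\<And>x y. h (x + y) = h x + h y"
  shows "(CLINT x|measure_pmf (iid_sum \<kappa> n). iexp (s * h x)) = (CLINT x|measure_pmf \<kappa>. iexp (s * h x)) ^ n"
proof (induction n)
  case 0
  have "h 0 = 0" using assms[of 0 0] by simp
  then show ?case by simp
next
  case (Suc n)
  then show ?case unfolding iid_sum.simps char_convolution[of h, OF assms] by simp
qed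

lemma char_compound_poisson:
  fixes h :: "'b::comm_monoid_add \<Rightarrow> real"
  assumes h: "\<And>x y. h (x + y) = h x + h y" and r: "0 < r"
  shows "(CLINT x|measure_pmf (compound_poisson r \<kappa>). iexp (s * h x)) =
    exp (of_real r * ((CLINT x|measure_pmf \<kappa>. iexp (s * h x)) - 1))"
proof -
  define \<phi> where "\<phi> = (CLINT x|measure_pmf \<kappa>. iexp (s * h x))"
  have "norm \<phi> \<le> (LINT x|measure_pmf \<kappa>. norm (iexp (s * h x)))"
    unfolding \<phi>_def by (rule integral_norm_bound)
  also have "\<dots> \<le> 1" by simp
  finally have "norm (\<phi> ^ n) \<le> 1" for n
    by (simp add: norm_power power_le_one)
  then have "(\<lambda>n. pmf (poisson_pmf r) n *\<^sub>R \<phi> ^ n) sums (LINT n|measure_pmf (poisson_pmf r). \<phi> ^ n)"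
    by (rule pmf_weighted_sums)
  moreover have "(\<lambda>n. pmf (poisson_pmf r) n *\<^sub>R \<phi> ^ n) sums (of_real (exp (- r)) * exp (of_real r * \<phi>))"
  proof -
    have "(\<lambda>n. of_real (exp (- r)) * ((of_real r * \<phi>) ^ n /\<^sub>R fact n)) sums (of_real (exp (- r)) * exp (of_real r * \<phi>))"
      by (intro sums_mult exp_converges)
    then show ?thesis
      using r by (simp add: scaleR_conv_of_real power_mult_distrib field_simps)
  qed
  ultimately have "(LINT n|measure_pmf (poisson_pmf r). \<phi> ^ n) = of_real (exp (- r)) * exp (of_real r * \<phi>)"
    using sums_unique2 by blast
  also have "\<dots> = exp (of_real r * (\<phi> - 1))"
    by (simp add: algebra_simps exp_of_real[symmetric] flip: exp_add)
  finally show ?thesis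
    unfolding compound_poisson_def \<phi>_def[symmetric]
    by (subst integral_bind_pmf_bounded[where B = 1], simp)
      (simp only: char_iid_sum[of h, OF h] flip: \<phi>_def)
qed

lemma compound_poisson_unique:
  fixes h :: "'b::comm_monoid_add \<Rightarrow> real"
  assumes "inj h" "\<And>x y. h (x + y) = h x + h y" "0 < r"
    and "\<And>s. (CLINT x|measure_pmf p. iexp (s * h x)) =
      exp (of_real r * ((CLINT x|measure_pmf \<kappa>. iexp (s * h x)) - 1))"
  shows "p = compound_poisson r \<kappa>"
  by (rule pmf_char_unique[OF assms(1)]) (simp only: assms char_compound_poisson[of h, OF assms(2,3)])

lemma pmf_compound_poisson_sums:
  "(\<lambda>n. pmf (poisson_pmf r) n * pmf (iid_sum \<kappa> n) x) sums pmf (compound_poisson r \<kappa>) x"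
  using pmf_weighted_sums[of "\<lambda>n. pmf (iid_sum \<kappa> n) x" 1 "poisson_pmf r"]
  by (simp add: compound_poisson_def pmf_bind pmf_le_1)

text \<open>The Poisson number of jumps equals one with positive probability. Hence a restriction on
  the support of the law is inherited by its jumps.\<close>

lemma set_compound_poisson_superset:
  assumes "0 < r"
  shows "set_pmf \<kappa> \<subseteq> set_pmf (compound_poisson r \<kappa>)"
proof
  fix x assume "x \<in> set_pmf \<kappa>"
  then have "x \<in> set_pmf (iid_sum \<kappa> (Suc 0))" by force
  then show "x \<in> set_pmf (compound_poisson r \<kappa>)"
    using assms unfolding compound_poisson_def set_bind_pmf set_pmf_poisson[OF assms] by blast
qed

lemma pmf_from_prob_space:
  fixes N :: "'b::countable measure"
  assumes "prob_space N" "sets N = UNIV"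
  shows "\<exists>p. measure_pmf p = N"
proof -
  interpret prob_space N by fact
  have "AE x in N. measure N {x} \<noteq> 0"
    using assms(2) by (subst AE_support_countable) (auto intro: exI[of _ UNIV])
  then show ?thesis
    using assms by (intro exI[of _ "Abs_pmf N"] Abs_pmf_inverse) auto
qed

text \<open>A finite jump measure is its total mass times a probability. The zero measure cannot be
  normalized; it is replaced by jumps of size 0 at rate 1, which have the same exponent because
  \<open>h 0 = 0\<close>.\<close>

lemma finite_measure_char_exponent:
  fixes N :: "'b::{countable, comm_monoid_add} measure" and h :: "'b \<Rightarrow> real"
  assumes "finite_measure N" and sets: "sets N = UNIV" and "h 0 = 0"
  shows "\<exists>r \<kappa>. 0 < r \<and> (\<forall>s. (CLINT u|N. (iexp (s * h u) - 1)) =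
    of_real r * ((CLINT u|measure_pmf \<kappa>. iexp (s * h u)) - 1))"
proof -
  interpret finite_measure N by fact
  have space: "space N = UNIV" using sets_eq_imp_space_eq[of N "count_space UNIV"] sets by simp
  have meas [measurable]: "f \<in> borel_measurable N" for f :: "'b \<Rightarrow> complex"
    using sets by (simp add: measurable_def)
  define r where "r = measure N UNIV"
  show ?thesis
  proof (cases "r = 0")
    case True
    then have "emeasure N (space N) = 0"
      by (simp add: emeasure_eq_measure space r_def)
    then have "AE u in N. False"
      by (intro AE_I[where N = "space N"]) auto
    then have "(CLINT u|N. (iexp (s * h u) - 1)) = 0" for s
      by (intro integral_eq_zero_AE) auto
    then show ?thesis
      using \<open>h 0 = 0\<close> by (intro exI[of _ 1] exI[of _ "return_pmf 0"]) auto
  next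
    case False
    then have r: "0 < r" by (simp add: r_def zero_less_measure_iff)
    define N' where "N' = density N (\<lambda>_. ennreal (1 / r))"
    have "emeasure N' (space N') = 1"
    proof -
      have "emeasure N' (space N') = ennreal (1 / r) * ennreal r"
        using sets by (simp add: N'_def emeasure_density_const space emeasure_eq_measure r_def)
      also have "\<dots> = 1"
        using r by (simp flip: ennreal_mult')
      finally show ?thesis .
    qed
    then have "prob_space N'" by (rule prob_spaceI)
    then obtain \<kappa> where \<kappa>: "measure_pmf \<kappa> = N'"
      using pmf_from_prob_space[of N'] by (auto simp: N'_def sets)
    have "(CLINT u|N. (iexp (s * h u) - 1)) = of_real r * ((CLINT u|measure_pmf \<kappa>. iexp (s * h u)) - 1)" for s
    proof -
      have int: "integrable N (\<lambda>u. iexp (s * h u))"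
        by (rule integrable_const_bound[where B = 1]) auto
      have "(CLINT u|measure_pmf \<kappa>. iexp (s * h u)) = (CLINT u|N. (1 / r) *\<^sub>R iexp (s * h u))"
        unfolding \<kappa> N'_def using r by (subst integral_density) auto
      also have "\<dots> = of_real (1 / r) * (CLINT u|N. iexp (s * h u))"
        by (simp add: scaleR_conv_of_real)
      moreover have "(CLINT u|N. (iexp (s * h u) - 1)) = (CLINT u|N. iexp (s * h u)) - of_real r"
        using int by (simp add: r_def space scaleR_conv_of_real)
      ultimately show ?thesis
        using r by (simp add: field_simps)
    qed
    with r show ?thesis by blast
  qed
qed

section \<open>Generating functions with the outer coordinates fixed\<close>

unbundle fps_syntax
unbundle no vec_syntax

definition slice :: "(nat \<times> nat \<times> nat) pmf \<Rightarrow> nat \<Rightarrow> nat \<Rightarrow> real fps" where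
  "slice p a c = Abs_fps (\<lambda>j. pmf p (a, j, c))"

lemma slice_nth [simp]: "slice p a c $ j = pmf p (a, j, c)"
  by (simp add: slice_def)

lemma slice_convolution:
  "slice (map_pmf (\<lambda>(x, y). x + y) (pair_pmf p q)) a c =
    (\<Sum>a'\<le>a. \<Sum>c'\<le>c. slice p a' c' * slice q (a - a') (c - c'))"
proof (rule fps_ext)
  fix j
  let ?g = "\<lambda>(a'::nat, c'::nat, j'::nat). ((a', j', c'), (a - a', j - j', c - c'))"
  let ?I = "{..a} \<times> {..c} \<times> {..j}"
  have "(\<lambda>(x, y). x + y) -` {(a, j, c)} = ?g ` ?I"
  proof (intro equalityI subsetI)
    fix z assume "z \<in> (\<lambda>(x, y). x + y) -` {(a, j, c)}"
    moreover obtain a1 j1 c1 a2 j2 c2 where "z = ((a1, j1, c1), (a2, j2, c2))" by (metis prod_cases3 surj_pair)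
    ultimately show "z \<in> ?g ` ?I"
      by (intro image_eqI[of _ _ "(a1, c1, j1)"]) auto
  qed auto
  then have "pmf (map_pmf (\<lambda>(x, y). x + y) (pair_pmf p q)) (a, j, c) = sum (pmf (pair_pmf p q)) (?g ` ?I)"
    by (simp only: pmf_map measure_measure_pmf_finite finite_imageI finite_cartesian_product finite_atMost)
  moreover have "inj_on ?g ?I" by (auto simp: inj_on_def)
  ultimately have "pmf (map_pmf (\<lambda>(x, y). x + y) (pair_pmf p q)) (a, j, c) =
      (\<Sum>(a', c', j')\<in>?I. pmf p (a', j', c') * pmf q (a - a', j - j', c - c'))"
    by (simp only: sum.reindex) (auto simp: pmf_pair intro!: sum.cong)
  also have "\<dots> = (\<Sum>a'\<le>a. \<Sum>c'\<le>c. \<Sum>j'\<le>j. pmf p (a', j', c') * pmf q (a - a', j - j', c - c'))"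
    by (simp add: sum.cartesian_product)
  finally show "slice (map_pmf (\<lambda>(x, y). x + y) (pair_pmf p q)) a c $ j =
      (\<Sum>a'\<le>a. \<Sum>c'\<le>c. slice p a' c' * slice q (a - a') (c - c')) $ j"
    by (simp add: fps_sum_nth fps_mult_nth atMost_atLeast0)
qed

context
  fixes \<kappa> :: "(nat \<times> nat \<times> nat) pmf"
begin

lemma slice_iid_0:
  "slice (iid_sum \<kappa> 0) a c = (if a = 0 \<and> c = 0 then 1 else 0)"
  by (rule fps_ext) (auto simp: zero_prod_def)

lemma slice_iid_Suc:
  "slice (iid_sum \<kappa> (Suc n)) a c =
    (\<Sum>a'\<le>a. \<Sum>c'\<le>c. slice \<kappa> a' c' * slice (iid_sum \<kappa> n) (a - a') (c - c'))"
  by (simp add: slice_convolution)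

text \<open>Exactly one summand has outer coordinates \<open>(1, 0)\<close> and all others have
  \<open>(0, 0)\<close>; the factor counts its possible positions.\<close>

lemma slice_iid_10:
  "slice (iid_sum \<kappa> (Suc n)) 1 0 = of_nat (Suc n) * (slice \<kappa> 1 0 * slice (iid_sum \<kappa> n) 0 0)"
proof (induction n)
  case (Suc n)
  have "slice (iid_sum \<kappa> (Suc (Suc n))) 1 0 =
      slice \<kappa> 0 0 * slice (iid_sum \<kappa> (Suc n)) 1 0 + slice \<kappa> 1 0 * slice (iid_sum \<kappa> (Suc n)) 0 0"
    unfolding slice_iid_Suc[of "Suc n"] by simp
  also have "slice (iid_sum \<kappa> (Suc n)) 0 0 = slice \<kappa> 0 0 * slice (iid_sum \<kappa> n) 0 0"
    by (simp add: slice_iid_Suc del: iid_sum.simps)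
  finally show ?case
    unfolding Suc.IH by (simp add: algebra_simps slice_iid_Suc[of n 0 0] del: iid_sum.simps)
qed (simp add: slice_iid_Suc slice_iid_0 del: iid_sum.simps)

text \<open>Mark the unique summand whose first coordinate is 1. Either it also has third coordinate
  1, or the remaining \<open>n\<close> summands supply that unit. Leaving their contribution as the
  slice \<open>0 1\<close> keeps a single factor \<open>Suc n\<close>.\<close>

lemma slice_iid_11:
  "slice (iid_sum \<kappa> (Suc n)) 1 1 = of_nat (Suc n) *
    (slice \<kappa> 1 1 * slice (iid_sum \<kappa> n) 0 0 + slice \<kappa> 1 0 * slice (iid_sum \<kappa> n) 0 1)"
proof (induction n)
  case (Suc n)
  have "slice (iid_sum \<kappa> (Suc (Suc n))) 1 1 =
      slice \<kappa> 0 0 * slice (iid_sum \<kappa> (Suc n)) 1 1 + slice \<kappa> 0 1 * slice (iid_sum \<kappa> (Suc n)) 1 0 +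
      (slice \<kappa> 1 0 * slice (iid_sum \<kappa> (Suc n)) 0 1 + slice \<kappa> 1 1 * slice (iid_sum \<kappa> (Suc n)) 0 0)"
    unfolding slice_iid_Suc[of "Suc n"] by simp
  moreover have "slice (iid_sum \<kappa> (Suc n)) 0 0 = slice \<kappa> 0 0 * slice (iid_sum \<kappa> n) 0 0"
    "slice (iid_sum \<kappa> (Suc n)) 0 1 = slice \<kappa> 0 0 * slice (iid_sum \<kappa> n) 0 1 + slice \<kappa> 0 1 * slice (iid_sum \<kappa> n) 0 0"
    by (simp_all add: slice_iid_Suc del: iid_sum.simps)
  ultimately show ?case
    unfolding Suc.IH slice_iid_10 by (simp add: algebra_simps del: iid_sum.simps)
qed (simp add: slice_iid_Suc slice_iid_0 del: iid_sum.simps)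

lemma sums_fps_mult:
  fixes A :: "nat \<Rightarrow> real fps"
  assumes "\<And>j. (\<lambda>n. w n * A n $ j) sums (F $ j)"
  shows "(\<lambda>n. w n * (B * A n) $ j) sums ((B * F) $ j)"
proof -
  have "(\<lambda>n. \<Sum>i=0..j. B $ i * (w n * A n $ (j - i))) sums (\<Sum>i=0..j. B $ i * F $ (j - i))"
    by (intro sums_sum sums_mult assms)
  then show ?thesis
    by (simp add: fps_mult_nth sum_distrib_left mult_ac)
qed

context
  fixes r :: real
  assumes r: "0 < r"
begin

lemma slice_compound_sums:
  "(\<lambda>n. pmf (poisson_pmf r) n * slice (iid_sum \<kappa> n) a c $ j) sums (slice (compound_poisson r \<kappa>) a c $ j)"
  using pmf_compound_poisson_sums by simp

text \<open>Poisson weights satisfy (n + 1) P(n + 1) = r P(n). The factor \<open>Suc n\<close> from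
  marking a summand is thus absorbed, and what remains is a sum over a Poisson number of unmarked
  summands.\<close>

lemma compound_slice_eqI:
  assumes zero: "slice (iid_sum \<kappa> 0) a c = 0"
    and Suc: "\<And>n. slice (iid_sum \<kappa> (Suc n)) a c = of_nat (Suc n) * H n"
    and H: "\<And>j. (\<lambda>n. pmf (poisson_pmf r) n * H n $ j) sums (G $ j)"
  shows "slice (compound_poisson r \<kappa>) a c = fps_const r * G"
proof (rule fps_ext)
  fix j
  have "pmf (poisson_pmf r) (Suc n) * slice (iid_sum \<kappa> (Suc n)) a c $ j = r * (pmf (poisson_pmf r) n * H n $ j)" for n
    unfolding Suc using r by (simp add: fps_of_nat[symmetric] divide_simps del: of_nat_Suc fps_const_add)
  moreover have "(\<lambda>n. r * (pmf (poisson_pmf r) n * H n $ j)) sums (r * G $ j)"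
    by (intro sums_mult H)
  ultimately have "(\<lambda>n. pmf (poisson_pmf r) (Suc n) * slice (iid_sum \<kappa> (Suc n)) a c $ j) sums (r * G $ j)"
    by simp
  then have "(\<lambda>n. pmf (poisson_pmf r) n * slice (iid_sum \<kappa> n) a c $ j) sums (r * G $ j)"
    using zero by (subst (asm) sums_Suc_iff) (simp del: slice_nth iid_sum.simps)
  then show "slice (compound_poisson r \<kappa>) a c $ j = (fps_const r * G) $ j"
    using sums_unique2[OF slice_compound_sums] by fastforce
qed

text \<open>In \<open>?F 1 1\<close> the two outer units come either from one jump or from two
  separate jumps. The second contribution equals the product subtracted on the left, so only the
  jumps carrying both units survive.\<close>

lemma compound_slice_determinant:
  "slice (compound_poisson r \<kappa>) 0 0 * slice (compound_poisson r \<kappa>) 1 1 -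
    slice (compound_poisson r \<kappa>) 1 0 * slice (compound_poisson r \<kappa>) 0 1 =
    (slice (compound_poisson r \<kappa>) 0 0)\<^sup>2 * (fps_const r * slice \<kappa> 1 1)"
proof -
  let ?F = "slice (compound_poisson r \<kappa>)"
  have "?F 1 0 = fps_const r * (slice \<kappa> 1 0 * ?F 0 0)"
    by (intro compound_slice_eqI[OF _ slice_iid_10] sums_fps_mult slice_compound_sums) (simp add: slice_iid_0 del: iid_sum.simps)
  moreover have "?F 1 1 = fps_const r * (slice \<kappa> 1 1 * ?F 0 0 + slice \<kappa> 1 0 * ?F 0 1)"
  proof (rule compound_slice_eqI[OF _ slice_iid_11])
    show "(\<lambda>n. pmf (poisson_pmf r) n * (slice \<kappa> 1 1 * slice (iid_sum \<kappa> n) 0 0 + slice \<kappa> 1 0 * slice (iid_sum \<kappa> n) 0 1) $ j)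
        sums ((slice \<kappa> 1 1 * ?F 0 0 + slice \<kappa> 1 0 * ?F 0 1) $ j)" for j
      unfolding fps_add_nth distrib_left by (intro sums_add sums_fps_mult slice_compound_sums)
  qed (simp add: slice_iid_0 del: iid_sum.simps)
  ultimately show ?thesis
    by (simp add: algebra_simps power2_eq_square)
qed

end

end

section \<open>Characterization of the Poisson family\<close>

text \<open>Cauchy's functional equation. Nonnegativity makes \<open>f\<close> monotone, so
  \<open>f x\<close> stays within \<open>f 1\<close> of \<open>x * f 1\<close> for all positive
  \<open>x\<close>, whereas a discrepancy at \<open>s\<close> would grow linearly along the
  multiples of \<open>s\<close>.\<close>

lemma additive_nonneg_linear:
  fixes f :: "real \<Rightarrow> real"
  assumes add: "\<And>s u. 0 < s \<Longrightarrow> 0 < u \<Longrightarrow> f (s + u) = f s + f u"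
    and nonneg: "\<And>s. 0 < s \<Longrightarrow> 0 \<le> f s" and s: "0 < s"
  shows "f s = s * f 1"
proof (rule ccontr)
  assume ne: "f s \<noteq> s * f 1"
  have mult: "f (real (Suc n) * u) = real (Suc n) * f u" if "0 < u" for n u
  proof (induction n)
    case (Suc n)
    have "f (real (Suc n) * u + u) = f (real (Suc n) * u) + f u"
      using that by (intro add) auto
    then show ?case using Suc by (simp add: algebra_simps)
  qed simp
  have mono: "f u \<le> f v" if "0 < u" "u \<le> v" for u v
  proof (cases "u = v")
    case False
    then show ?thesis using that add[of u "v - u"] nonneg[of "v - u"] by simp
  qed simp
  have bound: "\<bar>real (Suc n) * f s - real (Suc n) * s * f 1\<bar> \<le> f 1" for n
  proof -
    define x where "x = real (Suc n) * s"
    define m where "m = nat \<lfloor>x\<rfloor>"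
    have x: "0 < x" using s by (simp add: x_def)
    have m: "real m \<le> x" "x \<le> real (Suc m)"
      using x by (auto simp: m_def intro: of_nat_floor) linarith+
    have "f x \<le> f (real (Suc m) * 1)" using x m by (intro mono) auto
    also have "\<dots> = real (Suc m) * f 1" by (rule mult) simp
    finally have up: "f x \<le> real (Suc m) * f 1" .
    have low: "real m * f 1 \<le> f x"
    proof (cases m)
      case (Suc m')
      then have "f (real (Suc m') * 1) \<le> f x" using m by (intro mono) auto
      then show ?thesis using mult[of 1 m'] Suc by simp
    qed (use nonneg[OF x] in simp)
    have "real m * f 1 \<le> x * f 1" "x * f 1 \<le> real (Suc m) * f 1"
      using m nonneg[of 1] by (auto intro: mult_right_mono)
    then have "\<bar>f x - x * f 1\<bar> \<le> f 1"
      using up low by (simp add: distrib_right abs_le_iff)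
    then show ?thesis using mult[OF s, of n] by (simp add: x_def)
  qed
  obtain n where "f 1 < real n * \<bar>f s - s * f 1\<bar>"
    using reals_Archimedean3[of "\<bar>f s - s * f 1\<bar>"] ne by auto
  also have "\<dots> \<le> real (Suc n) * \<bar>f s - s * f 1\<bar>"
    by (intro mult_right_mono) auto
  also have "\<dots> = \<bar>real (Suc n) * (f s - s * f 1)\<bar>"
    by (simp only: abs_mult abs_of_nat)
  also have "real (Suc n) * (f s - s * f 1) = real (Suc n) * f s - real (Suc n) * s * f 1"
    by (simp only: right_diff_distrib mult.assoc)
  also have "\<bar>real (Suc n) * f s - real (Suc n) * s * f 1\<bar> \<le> f 1" by (rule bound)
  finally show False by simp
qed

lemma exp_add_convolution:
  fixes a b :: real
  shows "(a + b) ^ k / fact k = (\<Sum>i\<le>k. (a ^ i / fact i) * (b ^ (k - i) / fact (k - i)))"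
  using arg_cong[OF fps_exp_add_mult[of a b], where f = "\<lambda>F. F $ k"]
  by (simp add: fps_mult_nth atMost_atLeast0)

section \<open>Masses relative to the mass at zero\<close>

context charging_semigroup
begin

text \<open>This normalization keeps the convolution identity, makes the term of order zero equal to
  1 and removes the exponential factor: a Poisson law with mean c has ratios c^k / k!.\<close>

definition ratio :: "real \<Rightarrow> nat \<Rightarrow> real" where
  "ratio s k = pmf (\<mu> s) k / pmf (\<mu> s) 0"

lemma ratio_0: "0 < s \<Longrightarrow> ratio s 0 = 1"
  using full_support[of s 0] by (simp add: ratio_def)

lemma ratio_pos: "0 < s \<Longrightarrow> 0 < ratio s k"
  using full_support by (simp add: ratio_def)

lemma ratio_add: "0 < s \<Longrightarrow> 0 < u \<Longrightarrow> ratio (s + u) k = (\<Sum>i\<le>k. ratio s i * ratio u (k - i))"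
  using pmf_add[of s u k] pmf_add[of s u 0]
  by (simp add: ratio_def sum_divide_distrib)

text \<open>The only possible mean per unit of parameter, since a Poisson law has its mean as the
  ratio of order one.\<close>

definition rate :: real where "rate = ratio 1 1"

lemma rate_pos: "0 < rate"
  by (simp add: rate_def ratio_pos)

lemma ratio_1: "0 < s \<Longrightarrow> ratio s 1 = rate * s"
  using additive_nonneg_linear[of "\<lambda>s. ratio s 1" s] ratio_pos
  by (simp add: rate_def ratio_add ratio_0 less_imp_le mult.commute)

lemma ratio_excess_zero:
  assumes k: "2 \<le> k"
    and IH: "\<And>j s. j < k \<Longrightarrow> 0 < s \<Longrightarrow> ratio s j = (rate * s) ^ j / fact j"
    and \<theta>: "0 < \<theta>" "ratio \<theta> k \<le> (rate * \<theta>) ^ k / fact k"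
    and s: "0 < s"
  shows "ratio s k = (rate * s) ^ k / fact k"
proof -
  define x where "x s = ratio s k - (rate * s) ^ k / fact k" for s
  have add: "x (s + u) = x s + x u" if su: "0 < s" "0 < u" for s u
  proof -
    have split: "(\<Sum>i\<le>k. g i) = g 0 + g k + (\<Sum>i\<in>{0<..<k}. g i)" for g :: "nat \<Rightarrow> real"
    proof -
      have "{..k} = insert 0 (insert k {0<..<k})" using k by auto
      then show ?thesis using k by simp
    qed
    have "x (s + u) = (\<Sum>i\<le>k. ratio s i * ratio u (k - i)) -
        (\<Sum>i\<le>k. ((rate * s) ^ i / fact i) * ((rate * u) ^ (k - i) / fact (k - i)))"
      using su exp_add_convolution[of "rate * s" "rate * u" k] by (simp add: x_def ratio_add distrib_left)
    \<comment> \<open>In the inner terms both orders are below \<open>k\<close>, so they agree with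
      the Poisson terms. The two end terms leave exactly the two excesses, as the ratios of order
      zero are 1.\<close>
    also have "(\<Sum>i\<in>{0<..<k}. ratio s i * ratio u (k - i)) =
        (\<Sum>i\<in>{0<..<k}. ((rate * s) ^ i / fact i) * ((rate * u) ^ (k - i) / fact (k - i)))"
      using su by (intro sum.cong) (auto simp: IH)
    then have "(\<Sum>i\<le>k. ratio s i * ratio u (k - i)) -
        (\<Sum>i\<le>k. ((rate * s) ^ i / fact i) * ((rate * u) ^ (k - i) / fact (k - i))) = x s + x u"
      unfolding split using su by (simp add: ratio_0 x_def)
    finally show ?thesis .
  qed
  have mult: "x (real (Suc n) * u) = real (Suc n) * x u" if "0 < u" for n u
  proof (induction n)
    case (Suc n)
    have "x (real (Suc n) * u + u) = x (real (Suc n) * u) + x u"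
      using that by (intro add) auto
    then show ?case using Suc by (simp add: algebra_simps)
  qed simp
  \<comment> \<open>Divide \<open>s\<close> into \<open>N\<close> equal parts. Ratios are positive,
    so the excess of each part is at least minus its Poisson term, which is of order N^(-k). The sum
    of \<open>N\<close> such bounds is at most a constant over \<open>N\<close>, because
    \<open>k\<close> is at least 2.\<close>
  have nonneg: "0 \<le> x s" if s: "0 < s" for s
  proof (rule ccontr)
    assume "\<not> 0 \<le> x s"
    then obtain n where n: "(rate * s) ^ k / fact k < real n * - x s"
      using reals_Archimedean3[of "- x s"] by auto
    define N where "N = real (Suc n)"
    have N: "1 \<le> N" by (simp add: N_def)
    have "- x (s / N) \<le> (rate * (s / N)) ^ k / fact k"
      using ratio_pos[of "s / N" k] s N by (simp add: x_def)
    then have "N * - x (s / N) \<le> N * ((rate * (s / N)) ^ k / fact k)"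
      using N by (intro mult_left_mono) auto
    moreover have "x s = N * x (s / N)"
      using mult[of "s / N" n] s N unfolding N_def[symmetric] by simp
    ultimately have "- x s \<le> N * ((rate * (s / N)) ^ k / fact k)"
      by simp
    also have "\<dots> = (rate * s) ^ k / fact k / N ^ (k - 1)"
    proof -
      obtain j where j: "k = Suc j" using k by (cases k) auto
      have "(rate * (s / N)) ^ k = (rate * s) ^ k / N ^ k"
        by (simp only: times_divide_eq_right power_divide)
      then show ?thesis using N by (simp only: j) (simp add: field_simps del: fact_Suc)
    qed
    also have "\<dots> \<le> (rate * s) ^ k / fact k / N"
      using N k s rate_pos self_le_power[of N "k - 1"] by (intro divide_left_mono) auto
    finally have "N * - x s \<le> (rate * s) ^ k / fact k"
      using N by (simp add: field_simps)
    moreover have "real n * - x s \<le> N * - x s"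
      using \<open>\<not> 0 \<le> x s\<close> by (intro mult_right_mono) (auto simp: N_def)
    ultimately show False using n by simp
  qed
  \<comment> \<open>The hypothesis at \<open>\<theta>\<close> gives the opposite inequality, and a
    linear function with one positive zero vanishes.\<close>
  have "x \<theta> = 0" using nonneg[of \<theta>] \<theta> by (simp add: x_def)
  then have "x 1 = 0"
    using additive_nonneg_linear[of x \<theta>] add nonneg \<theta> by simp
  then have "x s = 0"
    using additive_nonneg_linear[of x s] add nonneg s by simp
  then show ?thesis by (simp add: x_def)
qed

lemma poisson_familyI:
  assumes ratio: "\<And>k s. 0 < s \<Longrightarrow> ratio s k = (rate * s) ^ k / fact k"
  shows "poisson_family \<mu>"
  unfolding poisson_family_def
proof (intro exI conjI allI impI)
  show "0 < rate" by (rule rate_pos)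
  show "\<mu> 0 = return_pmf 0" using semigroup by (simp add: conv_semigroup_def)
  fix s :: real assume s: "0 < s"
  have pmf: "pmf (\<mu> s) k = pmf (\<mu> s) 0 * ((rate * s) ^ k /\<^sub>R fact k)" for k
    using ratio[OF s, of k] full_support[OF s, of 0] by (simp add: ratio_def field_simps)
  have "(\<lambda>k. pmf (\<mu> s) 0 * ((rate * s) ^ k /\<^sub>R fact k)) sums (pmf (\<mu> s) 0 * exp (rate * s))"
    by (intro sums_mult exp_converges)
  then have "pmf (\<mu> s) sums (pmf (\<mu> s) 0 * exp (rate * s))"
    unfolding pmf[symmetric] .
  then have "pmf (\<mu> s) 0 * exp (rate * s) = 1"
    using pmf_nat_sums sums_unique2 by blast
  then have zero: "pmf (\<mu> s) 0 = exp (- (rate * s))"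
    by (simp add: exp_minus field_simps)
  show "\<mu> s = poisson_pmf (rate * s)"
  proof (rule pmf_eqI)
    show "pmf (\<mu> s) k = pmf (poisson_pmf (rate * s)) k" for k
      unfolding pmf[of k] zero using s rate_pos by (simp add: field_simps)
  qed
qed

text \<open>
  Up to constant factors, \<open>m\<close>, \<open>d\<close> and \<open>e\<close> are the parts of the generating functions \<open>F a c\<close>
  above.  In the Poisson case \<open>m = exp (a t)\<close>, \<open>d\<close> and \<open>e\<close> are multiples of its first and
  second \<open>t d/dt\<close>-derivatives, and \<open>l\<close> is linear.  Only the term \<open>l $ 1\<close> is needed in the
  comparison of the coefficients of order \<open>k\<close>, where \<open>e $ k\<close> is the only one that differs.
\<close>

lemma ratio_le_of_quadratic:
  assumes \<theta>: "0 < \<theta>" and \<beta>: "0 < \<beta>" and k: "2 \<le> k"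
    and IH: "\<And>j s. j < k \<Longrightarrow> 0 < s \<Longrightarrow> ratio s j = (rate * s) ^ j / fact j"
    and m: "\<And>i. m $ i = (ratio \<beta> i)\<^sup>2 / ratio \<theta> i"
    and d: "\<And>i. d $ i = (if i = 0 then 0 else ratio \<beta> i * ratio \<beta> (i - 1) / ratio \<theta> i)"
    and e: "\<And>i. e $ i = (if i = 0 then 0 else (ratio \<beta> (i - 1))\<^sup>2 / ratio \<theta> i)"
    and quad: "m * e - d\<^sup>2 = m\<^sup>2 * l" and nonneg: "\<And>i. 0 \<le> (l :: real fps) $ i"
  shows "ratio \<theta> k \<le> (rate * \<theta>) ^ k / fact k"
proof -
  \<comment> \<open>With Poisson ratios, \<open>m $ i\<close> is (b^i / i!)^2 divided by (rate *
    \<theta>)^i / i!, that is a^i / i!. Lowering one or both of the orders in the numerator then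
    multiplies by i / b or by (i / b)^2, giving \<open>d\<close> and \<open>e\<close>.\<close>
  define a b where "a = (rate * \<beta>)\<^sup>2 / (rate * \<theta>)" and "b = rate * \<beta>"
  have pos: "0 < a" "0 < b" "0 < rate * \<theta>" using \<theta> \<beta> rate_pos by (auto simp: a_def b_def)
  have a: "rate * \<theta> = b\<^sup>2 / a" using pos rate_pos \<theta> \<beta> by (simp add: a_def b_def field_simps power2_eq_square)
  define E D Q where "E = fps_exp a" and "D = fps_X * fps_deriv E" and "Q = fps_X * fps_deriv D"
  have E: "E $ i = a ^ i / fact i" for i
    by (simp add: E_def)
  have "D $ i = real i * E $ i" for i
    by (cases i) (simp_all add: D_def)
  then have D: "D $ i = real i * a ^ i / fact i" for i
    by (simp add: E)
  have "Q $ i = real i * D $ i" for i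
    by (cases i) (simp_all add: Q_def)
  then have Q: "Q $ i = (real i)\<^sup>2 * a ^ i / fact i" for i
    by (simp add: D power2_eq_square)
  have \<beta>_ratio: "ratio \<beta> i = b ^ i / fact i" if "i < k" for i
    using that \<beta> by (simp add: IH b_def)
  have \<theta>_ratio: "ratio \<theta> i = b ^ i * b ^ i / (a ^ i * fact i)" if "i < k" for i
    using that \<theta> unfolding IH[OF that \<theta>] a by (simp add: power_divide power2_eq_square power_mult_distrib)
  have mE: "m $ i = E $ i" if "i < k" for i
    using that pos by (simp add: m \<beta>_ratio \<theta>_ratio E power2_eq_square)
  have dD: "d $ i = D $ i / b" if "i < k" for i
  proof (cases i)
    case (Suc j)
    have "d $ i = (b ^ i / fact i) * (b ^ j / fact j) / (b ^ i * b ^ i / (a ^ i * fact i))"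
      using that Suc by (simp add: d \<beta>_ratio \<theta>_ratio del: fact_Suc power_Suc)
    also have "\<dots> = a ^ i * b ^ j / (fact j * b ^ i)"
      using pos by (simp add: field_simps)
    also have "\<dots> = a ^ i / (fact j * b)"
      using pos by (simp add: Suc)
    also have "\<dots> = real i * a ^ i / (real i * fact j) / b"
      using Suc by simp
    finally show ?thesis by (simp add: D Suc)
  qed (simp add: d D)
  have eQ: "e $ i = Q $ i / b\<^sup>2" if "i < k" for i
  proof (cases i)
    case (Suc j)
    have "e $ i = (b ^ j / fact j)\<^sup>2 / (b ^ i * b ^ i / (a ^ i * fact i))"
      using that Suc by (simp add: e \<beta>_ratio \<theta>_ratio del: fact_Suc power_Suc)
    also have "\<dots> = a ^ i * fact i / ((fact j)\<^sup>2 * b\<^sup>2)"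
      using pos by (simp add: Suc field_simps power2_eq_square del: fact_Suc)
    also have "\<dots> = (real i)\<^sup>2 * a ^ i / fact i / b\<^sup>2"
    proof -
      have "fact i = real i * fact j" "i \<noteq> 0" by (simp_all add: Suc)
      then show ?thesis by (simp add: power2_eq_square)
    qed
    finally show ?thesis by (simp add: Q)
  qed (simp add: e Q)
  \<comment> \<open>Here D = a X E and Q = a X E + a^2 X^2 E, so the squares cancel. After division
    by b^2 this is the Poisson instance of \<open>quad\<close>, with l = (a / b^2) X.\<close>
  have EQ: "E * Q - D\<^sup>2 = fps_const a * fps_X * E\<^sup>2"
  proof -
    have dE: "fps_deriv E = fps_const a * E" by (simp add: E_def)
    have dD: "fps_deriv D = fps_const a * E + fps_X * (fps_const a * (fps_const a * E))"
      by (simp add: D_def dE)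
    show ?thesis
      unfolding Q_def unfolding dD unfolding D_def unfolding dE
      by (simp only: power2_eq_square algebra_simps)
  qed
  have m0: "m $ 0 = 1" using mE[of 0] k by (simp add: E)
  have l0: "l $ 0 = 0"
  proof -
    have "(m\<^sup>2 * l) $ 0 = l $ 0" by (simp add: power2_eq_square m0)
    moreover have "(m * e - d\<^sup>2) $ 0 = 0" by (simp add: power2_eq_square e d)
    ultimately show ?thesis unfolding quad by (rule trans[OF sym])
  qed
  \<comment> \<open>As \<open>k\<close> is at least 2, order 1 is already covered by the hypothesis,
    so \<open>l $ 1\<close> has its Poisson value.\<close>
  have l1: "l $ 1 = a / b\<^sup>2"
  proof -
    have "(m\<^sup>2 * l) $ 1 = l $ 1"
      using l0 by (simp add: power2_eq_square m0 fps_mult_nth)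
    moreover have "(m * e - d\<^sup>2) $ 1 = a / b\<^sup>2"
    proof -
      have "e $ 1 = a / b\<^sup>2" using eQ[of 1] k by (simp add: Q)
      then show ?thesis by (simp add: power2_eq_square fps_mult_nth m0 e[of 0] d[of 0])
    qed
    ultimately show ?thesis unfolding quad by (rule trans[OF sym])
  qed
  have split: "(\<Sum>i=0..k. g i) = g 0 + g k + (\<Sum>i\<in>{0<..<k}. g i)" for g :: "nat \<Rightarrow> real"
  proof -
    have "{0..k} = insert 0 (insert k {0<..<k})" using k by auto
    then show ?thesis using k by simp
  qed
  \<comment> \<open>The unknown \<open>m $ k\<close> is multiplied by \<open>e $ 0 = 0\<close>, and
    likewise \<open>d $ k\<close> below by \<open>d $ 0 = 0\<close>; only \<open>e $ k\<close>
    remains.\<close>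
  have "(m * e) $ k = (E * Q) $ k / b\<^sup>2 + (e $ k - Q $ k / b\<^sup>2)"
  proof -
    have "(\<Sum>i\<in>{0<..<k}. m $ i * e $ (k - i)) = (\<Sum>i\<in>{0<..<k}. E $ i * Q $ (k - i)) / b\<^sup>2"
      unfolding sum_divide_distrib by (intro sum.cong) (auto simp: mE eQ)
    then show ?thesis
      unfolding fps_mult_nth split by (simp add: m0 e[of 0] E Q add_divide_distrib)
  qed
  moreover have "(d\<^sup>2) $ k = (D\<^sup>2) $ k / b\<^sup>2"
  proof -
    have "(\<Sum>i\<in>{0<..<k}. d $ i * d $ (k - i)) = (\<Sum>i\<in>{0<..<k}. D $ i * D $ (k - i)) / b\<^sup>2"
      unfolding sum_divide_distrib by (intro sum.cong) (auto simp: dD power2_eq_square)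
    then show ?thesis
      unfolding fps_mult_nth split power2_eq_square[of d] power2_eq_square[of D] by (simp add: d[of 0] D)
  qed
  ultimately have "(m\<^sup>2 * l) $ k = (E * Q - D\<^sup>2) $ k / b\<^sup>2 + (e $ k - Q $ k / b\<^sup>2)"
    unfolding quad[symmetric] fps_sub_nth by (simp only: diff_divide_distrib)
  moreover have "(E * Q - D\<^sup>2) $ k = a * (E\<^sup>2) $ (k - 1)"
    unfolding EQ using k by (simp add: mult.assoc)
  \<comment> \<open>Only the summand with index \<open>k - 1\<close> is kept; it involves
    \<open>l $ 1\<close> and orders of \<open>m\<close> below \<open>k\<close>, all at their Poisson
    values. The discarded summands are nonnegative.\<close>
  moreover have "(E\<^sup>2) $ (k - 1) * (a / b\<^sup>2) \<le> (m\<^sup>2 * l) $ k"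
  proof -
    have m_nonneg: "0 \<le> m $ i" for i
      using ratio_pos \<theta> by (simp add: m less_imp_le)
    have "(m\<^sup>2) $ (k - 1) = (E\<^sup>2) $ (k - 1)"
      unfolding power2_eq_square fps_mult_nth using k by (intro sum.cong) (auto simp: mE)
    then have "(E\<^sup>2) $ (k - 1) * (a / b\<^sup>2) = (m\<^sup>2) $ (k - 1) * l $ (k - (k - 1))"
      using k l1 by simp
    also have "\<dots> \<le> (\<Sum>i=0..k. (m\<^sup>2) $ i * l $ (k - i))"
      using m_nonneg nonneg
      by (intro member_le_sum[of "k - 1" _ "\<lambda>i. (m\<^sup>2) $ i * l $ (k - i)"] mult_nonneg_nonneg)
         (auto simp: power2_eq_square fps_mult_nth intro!: sum_nonneg mult_nonneg_nonneg)
    finally show ?thesis by (simp add: fps_mult_nth)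
  qed
  \<comment> \<open>Since \<open>ratio \<theta> k\<close> is the denominator of
    \<open>e $ k\<close>, this lower bound turns into the desired upper bound.\<close>
  ultimately have "Q $ k / b\<^sup>2 \<le> e $ k" by (simp add: mult.commute[of a])
  moreover obtain j where j: "k = Suc j" using k by (cases k) auto
  then have "e $ k = (b ^ j / fact j)\<^sup>2 / ratio \<theta> k"
    using \<beta> by (simp add: e IH b_def)
  ultimately have "(real k)\<^sup>2 * a ^ k / fact k / b\<^sup>2 * ratio \<theta> k \<le> (b ^ j / fact j)\<^sup>2"
    unfolding Q pos_le_divide_eq[OF ratio_pos[OF \<theta>, of k], symmetric] by simp
  moreover have "0 < (real k)\<^sup>2 * a ^ k / fact k / b\<^sup>2"
    using pos k by simp
  ultimately have "ratio \<theta> k \<le> (b ^ j / fact j)\<^sup>2 / ((real k)\<^sup>2 * a ^ k / fact k / b\<^sup>2)"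
    by (subst pos_le_divide_eq) (simp_all only: mult.commute)
  also have "\<dots> = (b\<^sup>2 / a) ^ k / fact k"
  proof -
    have fact: "fact k = real k * fact j" "k \<noteq> 0" by (simp_all add: j)
    have "(b\<^sup>2) ^ k = (b ^ j)\<^sup>2 * b\<^sup>2" by (simp add: j power_mult_distrib power2_eq_square)
    then show ?thesis using fact pos by (simp add: power_divide power2_eq_square mult_ac)
  qed
  finally show ?thesis by (simp add: a)
qed

lemma poisson_family_of_quadratic:
  assumes "0 < \<theta>" "0 < \<beta>"
    and "\<And>i. m $ i = (ratio \<beta> i)\<^sup>2 / ratio \<theta> i"
    and "\<And>i. d $ i = (if i = 0 then 0 else ratio \<beta> i * ratio \<beta> (i - 1) / ratio \<theta> i)"
    and "\<And>i. e $ i = (if i = 0 then 0 else (ratio \<beta> (i - 1))\<^sup>2 / ratio \<theta> i)"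
    and "m * e - d\<^sup>2 = m\<^sup>2 * l" "\<And>i. 0 \<le> (l :: real fps) $ i"
  shows "poisson_family \<mu>"
proof (rule poisson_familyI)
  fix k and s :: real assume "0 < s"
  then show "ratio s k = (rate * s) ^ k / fact k"
  proof (induction k arbitrary: s rule: less_induct)
    case (less k)
    consider "k = 0" | "k = 1" | "2 \<le> k" by linarith
    then show ?case
    proof cases
      case 3
      have "ratio \<theta> k \<le> (rate * \<theta>) ^ k / fact k"
        by (rule ratio_le_of_quadratic[OF assms(1,2) 3 less.IH assms(3-7)])
      from ratio_excess_zero[OF 3 less.IH assms(1) this less.prems] show ?thesis .
    qed (use less.prems ratio_0 ratio_1 in auto)
  qed
qed

end

section \<open>Infinite divisibility of three consecutive variables\<close>

context charging_thinning
begin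

text \<open>From state 0 the common summand is 0; from state 1 it is 0 (coefficient
  \<open>A\<close>) or 1 (coefficient \<open>B\<close>, with the shifted masses \<open>r'\<close>).
  So the matrix of the slices is c L G L^T with L = ((x, 0), (A, B)) and G = ((m, d), (d, e)), and
  its determinant is c^2 x^2 B^2 (m e - d^2).\<close>

lemma poisson_family_of_compound:
  assumes P: "\<And>a b c. pmf P (a, b, c) = pmf pair_law (a, b) * pmf pair_law (b, c) / pmf (\<mu> \<theta>) b"
    and compound: "P = compound_poisson s \<kappa>" and s: "0 < s"
  shows "poisson_family \<mu>"
proof -
  define q r where "q = pmf (\<mu> (\<rho> * \<theta>))" and "r = pmf (\<mu> ((1 - \<rho>) * \<theta>))"
  define \<beta> where "\<beta> = (1 - \<rho>) * \<theta>"
  have \<beta>: "0 < \<beta>" using pos_\<theta> \<rho>_less by (simp add: \<beta>_def)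
  have pos: "0 < q i" "0 < r i" for i
    using full_support pos_\<theta> pos_\<rho> \<rho>_less by (simp_all add: q_def r_def)
  define r' where "r' i = (if i = 0 then 0 else r (i - 1))" for i
  have J0: "pmf pair_law (0, b) = q 0 * r 0 * r b" for b
    by (simp add: pair_law_def pmf_overlap q_def r_def)
  have J1: "pmf pair_law (1, b) = q 0 * r 1 * r b + q 1 * r 0 * r' b" for b
    by (cases b) (simp_all add: pair_law_def pmf_overlap q_def r_def r'_def atMost_Suc)
  have J_commute: "pmf pair_law (b, a) = pmf pair_law (a, b)" for a b
    by (simp add: pair_law_def pmf_overlap_commute[of _ _ b])
  define m where "m = Abs_fps (\<lambda>i. (ratio \<beta> i)\<^sup>2 / ratio \<theta> i)"
  define d where "d = Abs_fps (\<lambda>i. if i = 0 then 0 else ratio \<beta> i * ratio \<beta> (i - 1) / ratio \<theta> i)"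
  define e where "e = Abs_fps (\<lambda>i. if i = 0 then 0 else (ratio \<beta> (i - 1))\<^sup>2 / ratio \<theta> i)"
  \<comment> \<open>\<open>c\<close> restores the masses at zero that were divided out in
    \<open>ratio\<close>.\<close>
  define c where "c = (r 0)\<^sup>2 / pmf (\<mu> \<theta>) 0"
  have c: "0 < c" using pos(2)[of 0] start_pos[of 0] by (simp add: c_def)
  have mde: "c * m $ i = r i * r i / pmf (\<mu> \<theta>) i" "c * d $ i = r i * r' i / pmf (\<mu> \<theta>) i"
      "c * e $ i = r' i * r' i / pmf (\<mu> \<theta>) i" for i
    using pos[of 0] start_pos[of 0]
    by (auto simp: m_def d_def e_def c_def ratio_def \<beta>_def r'_def power2_eq_square simp flip: r_def)
  define x A B where "x = q 0 * r 0" and "A = q 0 * r 1" and "B = q 1 * r 0"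
  have xB: "x \<noteq> 0" "B \<noteq> 0" using pos[of 0] pos[of 1] by (simp_all add: x_def B_def)
  let ?C = "fps_const :: real \<Rightarrow> real fps"
  have S00: "slice P 0 0 = ?C x * ?C x * ?C c * m"
  proof (rule fps_ext)
    fix i
    have "slice P 0 0 $ i = x * x * (c * m $ i)"
      unfolding mde slice_nth P by (simp add: J_commute[of i 0] J0 x_def)
    then show "slice P 0 0 $ i = (?C x * ?C x * ?C c * m) $ i" by (simp add: mult.assoc)
  qed
  have S10: "slice P 1 0 = ?C x * ?C c * (?C A * m + ?C B * d)"
  proof (rule fps_ext)
    fix i
    have "slice P 1 0 $ i = x * (A * (c * m $ i) + B * (c * d $ i))"
      unfolding mde slice_nth P J1 J_commute[of i 0] J0
      by (simp add: x_def A_def B_def add_divide_distrib algebra_simps)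
    then show "slice P 1 0 $ i = (?C x * ?C c * (?C A * m + ?C B * d)) $ i" by (simp add: algebra_simps)
  qed
  have S01: "slice P 0 1 = ?C x * ?C c * (?C A * m + ?C B * d)"
  proof (rule fps_ext)
    fix i
    have "slice P 0 1 $ i = slice P 1 0 $ i"
      unfolding slice_nth P J_commute[of i] by (simp add: mult.commute)
    then show "slice P 0 1 $ i = (?C x * ?C c * (?C A * m + ?C B * d)) $ i" by (simp only: S10)
  qed
  have S11: "slice P 1 1 = ?C c * (?C A * ?C A * m + (?C A * ?C B * d + ?C A * ?C B * d) + ?C B * ?C B * e)"
  proof (rule fps_ext)
    fix i
    have "slice P 1 1 $ i = A * A * (c * m $ i) + (A * B * (c * d $ i) + A * B * (c * d $ i)) + B * B * (c * e $ i)"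
      unfolding mde slice_nth P J_commute[of i 1] J1
      by (simp add: A_def B_def add_divide_distrib[symmetric] algebra_simps)
    moreover have "(?C c * (?C A * ?C A * m + (?C A * ?C B * d + ?C A * ?C B * d) + ?C B * ?C B * e)) $ i =
        c * (A * (A * m $ i) + (A * (B * d $ i) + A * (B * d $ i)) + B * (B * e $ i))"
      by (simp only: mult.assoc fps_mult_left_const_nth fps_add_nth)
    ultimately show "slice P 1 1 $ i =
        (?C c * (?C A * ?C A * m + (?C A * ?C B * d + ?C A * ?C B * d) + ?C B * ?C B * e)) $ i"
      by (simp add: algebra_simps)
  qed
  \<comment> \<open>The square of \<open>slice P 0 0\<close> contributes x^4 c^2 m^2; cancelling c^2
    x^2 B^2 leaves the factor x^2 / B^2.\<close>
  define l where "l = ?C (x * x / (B * B)) * (?C s * slice \<kappa> 1 1)"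
  have l: "?C B * ?C B * l = ?C x * ?C x * (?C s * slice \<kappa> 1 1)"
    using xB by (simp add: l_def flip: mult.assoc)
  have "slice P 0 0 * slice P 1 1 - slice P 1 0 * slice P 0 1 = (slice P 0 0)\<^sup>2 * (?C s * slice \<kappa> 1 1)"
    unfolding compound by (rule compound_slice_determinant[OF s])
  moreover have "slice P 0 0 * slice P 1 1 - slice P 1 0 * slice P 0 1 =
      (?C x * ?C x * ?C c * ?C c) * (?C B * ?C B) * (m * e - d\<^sup>2)"
    unfolding S00 S10 S01 S11 by algebra
  ultimately have "(?C x * ?C x * ?C c * ?C c) * (?C B * ?C B) * (m * e - d\<^sup>2) =
      (?C x * ?C x * ?C c * ?C c) * m\<^sup>2 * (?C x * ?C x * (?C s * slice \<kappa> 1 1))"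
    unfolding S00 power2_eq_square by (simp only: mult_ac)
  then have "(?C x * ?C x * ?C c * ?C c * (?C B * ?C B)) * (m * e - d\<^sup>2) =
      (?C x * ?C x * ?C c * ?C c * (?C B * ?C B)) * (m\<^sup>2 * l)"
    unfolding l[symmetric] by (simp only: mult_ac)
  then have "m * e - d\<^sup>2 = m\<^sup>2 * l"
    using xB c by (subst (asm) mult_left_cancel) simp_all
  moreover have "0 \<le> l $ i" for i
    using s by (simp add: l_def)
  ultimately show ?thesis
    using pos_\<theta> \<beta> by (intro poisson_family_of_quadratic[of \<theta> \<beta> m d e l]) (simp_all add: m_def d_def e_def)
qed

lemma triple_law:
  obtains P where "measure_pmf P = distr M (count_space UNIV) (\<lambda>\<omega>. (X 0 \<omega>, X 1 \<omega>, X 2 \<omega>))"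
    "\<And>a b c. pmf P (a, b, c) = pmf pair_law (a, b) * pmf pair_law (b, c) / pmf (\<mu> \<theta>) b"
proof -
  have triple [measurable]: "(\<lambda>\<omega>. (X 0 \<omega>, X 1 \<omega>, X 2 \<omega>)) \<in> measurable M (count_space UNIV)"
    by measurable
  obtain P where P: "measure_pmf P = distr M (count_space UNIV) (\<lambda>\<omega>. (X 0 \<omega>, X 1 \<omega>, X 2 \<omega>))"
    using pmf_from_prob_space[OF prob_space_distr[OF triple]] by auto
  have "pmf P (a, b, c) = pmf pair_law (a, b) * pmf pair_law (b, c) / pmf (\<mu> \<theta>) b" for a b c
  proof -
    have "[0..2::int] = [0, 1, 2]" by (simp add: upto.simps)
    then have "prob {\<omega> \<in> space M. X 0 \<omega> = a \<and> X 1 \<omega> = b \<and> X 2 \<omega> = c} = weight [a, b, c]"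
      using window_prob[of 0 2 "[a, b, c]"] by simp
    also have "\<dots> = pmf pair_law (a, b) * pmf pair_law (b, c) / pmf (\<mu> \<theta>) b"
      using start_kernel[of a b] start_pos[of a]
      by (simp add: weight_def kernel_def)
    finally show ?thesis
      by (simp add: pmf.rep_eq P measure_distr vimage_def Int_def conj_commute)
  qed
  then show ?thesis using that P by blast
qed

lemma poisson_of_infinitely_divisible:
  assumes "id_marginals_all_orders M (\<lambda>t \<omega>. real (X t \<omega>))"
  shows "poisson_family \<mu>"
proof -
  let ?T = "{0, 1, 2} :: int set"
  obtain P where P: "measure_pmf P = distr M (count_space UNIV) (\<lambda>\<omega>. (X 0 \<omega>, X 1 \<omega>, X 2 \<omega>))"
    and pmf_P: "\<And>a b c. pmf P (a, b, c) = pmf pair_law (a, b) * pmf pair_law (b, c) / pmf (\<mu> \<theta>) b"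
    using triple_law by blast
  have "finite ?T" by simp
  with assms obtain \<nu> :: "(int \<Rightarrow> int) measure" where
    sets_\<nu>: "sets \<nu> = sets (\<Pi>\<^sub>M t\<in>?T. count_space UNIV)" and fin_\<nu>: "finite_measure \<nu>" and
    char: "\<And>w :: int \<Rightarrow> real. (CLINT x | joint_law M (\<lambda>t \<omega>. real (X t \<omega>)) ?T (\<lambda>t. t). iexp (\<Sum>t\<in>?T. w t * x t))
             = exp (CLINT u | \<nu>. (iexp (\<Sum>t\<in>?T. w t * of_int (u t)) - 1))"
    unfolding id_marginals_all_orders_def by blast
  obtain v :: real where v: "inj (\<lambda>(a::int, b::int, c::int). of_int a + of_int b * v + of_int c * v\<^sup>2)"
    using quadratic_relation_free by blast
  define h where "h = (\<lambda>(a::int, b::int, c::int). of_int a + of_int b * v + of_int c * v\<^sup>2)"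
  define emb where "emb = (\<lambda>(a, b, c). (int a, int b, int c))"
  have inj_emb: "inj emb" by (auto simp: inj_def emb_def)
  have h_add: "h (x + y) = h x + h y" for x y
    by (cases x; cases y) (simp add: h_def algebra_simps)
  have emb_add: "emb (x + y) = emb x + emb y" for x y
    by (cases x; cases y) (simp add: emb_def)
  define N where "N = distr \<nu> (count_space UNIV) (\<lambda>u. (u 0, u 1, u 2))"
  have "(\<lambda>u. (u 0, u 1, u 2)) \<in> measurable (\<Pi>\<^sub>M t\<in>?T. count_space (UNIV :: int set)) (count_space UNIV)"
    by measurable
  then have meas_\<nu>: "(\<lambda>u. (u 0, u 1, u 2)) \<in> measurable \<nu> (count_space UNIV)"
    by (simp only: measurable_cong_sets[OF sets_\<nu> refl])
  have fin_N: "finite_measure N"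
    unfolding N_def using fin_\<nu> meas_\<nu> by (rule finite_measure.finite_measure_distr)
  have h0: "h 0 = 0" by (simp add: h_def zero_prod_def)
  obtain s \<kappa> where s: "0 < s" and \<kappa>: "\<And>y. (CLINT u|N. (iexp (y * h u) - 1)) =
      of_real s * ((CLINT u|measure_pmf \<kappa>. iexp (y * h u)) - 1)"
  proof -
    have "sets N = UNIV" by (simp add: N_def)
    from finite_measure_char_exponent[of N h, OF fin_N this h0] show ?thesis using that by blast
  qed
  have char_P: "(CLINT z|measure_pmf P. iexp (y * h (emb z))) =
      exp (of_real s * ((CLINT u|measure_pmf \<kappa>. iexp (y * h u)) - 1))" for y
  proof -
    \<comment> \<open>These frequencies make the linear form on the three coordinates equal to
      \<open>y * h\<close>, so only one line of the three-dimensional characteristic function is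
      used.\<close>
    define w where "w t = y * (if t = 0 then 1 else if t = 1 then v else v\<^sup>2)" for t :: int
    have "(CLINT z|measure_pmf P. iexp (y * h (emb z))) =
        (CLINT \<omega>|M. iexp (y * h (emb (X 0 \<omega>, X 1 \<omega>, X 2 \<omega>))))"
      unfolding P by (rule integral_distr) measurable
    also have "\<dots> = (CLINT \<omega>|M. iexp (\<Sum>t\<in>?T. w t * (\<lambda>t\<in>?T. real (X t \<omega>)) t))"
      by (simp add: h_def emb_def w_def algebra_simps)
    also have "\<dots> = (CLINT x | joint_law M (\<lambda>t \<omega>. real (X t \<omega>)) ?T (\<lambda>t. t). iexp (\<Sum>t\<in>?T. w t * x t))"
      unfolding joint_law_def by (rule integral_distr[symmetric]) measurable
    also have "\<dots> = exp (CLINT u | \<nu>. (iexp (\<Sum>t\<in>?T. w t * of_int (u t)) - 1))"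
      by (rule char)
    also have "(CLINT u | \<nu>. (iexp (\<Sum>t\<in>?T. w t * of_int (u t)) - 1)) =
        (CLINT u | \<nu>. (iexp (y * h (u 0, u 1, u 2)) - 1))"
      by (simp add: h_def w_def algebra_simps)
    also have "\<dots> = (CLINT u|N. (iexp (y * h u) - 1))"
      unfolding N_def by (rule integral_distr[symmetric, OF meas_\<nu>]) simp
    finally show ?thesis unfolding \<kappa> .
  qed
  have inj_h: "inj h" using v by (simp add: h_def)
  have emb_P: "map_pmf emb P = compound_poisson s \<kappa>"
    by (rule compound_poisson_unique[OF inj_h h_add s]) (simp only: integral_map_pmf char_P)
  \<comment> \<open>The jumps are among the values of the law, which are embedded triples of
    naturals; therefore the jump law can be pulled back along \<open>emb\<close>.\<close>
  then have "set_pmf \<kappa> \<subseteq> range emb"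
    using set_compound_poisson_superset[OF s, of \<kappa>] by (auto simp flip: emb_P)
  then have \<kappa>_emb: "map_pmf emb (map_pmf (inv emb) \<kappa>) = \<kappa>"
    by (subst pmf.map_comp, intro map_pmf_idI) (auto simp: f_inv_into_f)
  have "P = compound_poisson s (map_pmf (inv emb) \<kappa>)"
  proof (rule compound_poisson_unique[of "h \<circ> emb"])
    show "inj (h \<circ> emb)" using inj_h inj_emb by (rule inj_compose)
    show "(CLINT z|measure_pmf P. iexp (y * (h \<circ> emb) z)) =
        exp (of_real s * ((CLINT u|measure_pmf (map_pmf (inv emb) \<kappa>). iexp (y * (h \<circ> emb) u)) - 1))" for y
      using char_P[of y] by (subst (asm) \<kappa>_emb[symmetric]) (simp only: integral_map_pmf o_def)
  qed (simp_all add: h_add emb_add s)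
  then show ?thesis
    by (rule poisson_family_of_compound[OF pmf_P _ s])
qed

end

theorem theorem2:
  fixes M :: "'a measure" and \<mu> :: "real \<Rightarrow> nat pmf" and \<theta> \<rho> :: real and t\<^sub>0 :: int
    and X \<xi> \<zeta> :: "int \<Rightarrow> 'a \<Rightarrow> nat"
  assumes "conv_semigroup \<mu>"
    and "\<And>s. 0 < s \<Longrightarrow> 0 < pmf (\<mu> s) 1"
    and "0 < \<theta>" and "0 < \<rho>" and "\<rho> < 1"
    and "thinning_process M \<mu> \<theta> \<rho> t\<^sub>0 X \<xi> \<zeta>"
  shows "(\<forall>t. distr M (count_space UNIV) (\<lambda>\<omega>. (X (t - 1) \<omega>, X t \<omega>)) =
           measure_pmf (map_pmf (\<lambda>(x, y, z). (x + y, x + z))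
             (pair_pmf (\<mu> (\<rho> * \<theta>)) (pair_pmf (\<mu> ((1 - \<rho>) * \<theta>)) (\<mu> ((1 - \<rho>) * \<theta>)))))) \<and>
         markov M (\<lambda>t \<omega>. real (X t \<omega>)) \<and>
         stationary M (\<lambda>t \<omega>. real (X t \<omega>)) \<and>
         time_reversible M (\<lambda>t \<omega>. real (X t \<omega>)) \<and>
         (\<forall>t. \<forall>\<omega>\<in>space M. real (X t \<omega>) \<in> \<nat>) \<and>
         (\<not> poisson_family \<mu> \<longrightarrow> \<not> id_marginals_all_orders M (\<lambda>t \<omega>. real (X t \<omega>)))"
proof -
  interpret thinning_process M \<mu> \<theta> \<rho> t\<^sub>0 X \<xi> \<zeta> by fact
  interpret charging_thinning M \<mu> \<theta> \<rho> t\<^sub>0 X \<xi> \<zeta>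
    using assms by unfold_locales
  show ?thesis
    using distr_pair markov_X stationary_X time_reversible_X poisson_of_infinitely_divisible
    by (auto simp: pair_law_def overlap_pmf_def)
qed

end
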